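(* (Cohomological reduction method.) Input: a finite group with a cohomological model $\{G,cohG,F,K,\phi\}$, i.e. a contraction with projection $F:\mathrm{Hom}(\bar B(\mathbb{Z}[G]),\mathbb{Z}_2)\to cohG$, injection $K: cohG\to \mathrm{Hom}(\bar B(\mathbb{Z}[G]),\mathbb{Z}_2)$ and homotopy $\phi$, with $cohG$ of finite type and codifferential $d$. Step 1. Construct a basis $\mathcal{E}$ for $i$-coboundaries, as follows. For $[g_1,\dots,g_{i-1}]\in\bar B_{i-1}(\mathbb{Z}[G])$ let $\partial_{[g_1,\dots,g_{i-1}]}$ be the $i$-coboundary associated to the characteristic map $\delta_{[g_1,\dots,g_{i-1}]}$ of $[g_1,\dots,g_{i-1}]$. With $|G|=4t$, regard the $4t\times\overset{i}{\cdots}\times 4t$ $i$-dimensional matrix of $\partial_{[g_1,\dots,g_{i-1}]}$ as a vector of length $4^it^i$, and let $C$ be the $4^{i-1}t^{i-1}\times 4^it^i$ matrix whose rows are these vectors. Perform a row reduction on $C$, and let $\mathcal{E}$ consist of those coboundaries $\partial_{[g_1,\dots,g_{i-1}]}$ whose transformed rows after the row reduction are not zero. Step 2. Construct a basis $\mathcal{B}$ for representative $i$-cocycles, as follows. Let $\{u_1,\dots,u_q\}$, $\mathcal{B}_i=\{e_1,\dots,e_r\}$, $\{v_1,\dots,v_s\}$ be bases for $cohG$ at dimensions $i-1$, $i$, $i+1$; let $M_{i-1}(d)$ ($q\times r$) and $M_i(d)$ ($r\times s$) be the matrices over $\mathbb{Z}_2$ with rows $d(u_1),\dots,d(u_q)$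 and $d(e_1),\dots,d(e_r)$, respectively; let $D_{i-1}=\begin{pmatrix}I_l&0\\0&0\end{pmatrix}$ and $D_i=\begin{pmatrix}I_k&0\\0&0\end{pmatrix}$ be their binary Smith normal forms, with change of basis matrices $P_j,Q_j$ such that $D_j=P_j\,M_j(d)\,Q_j$, $j=i-1,i$. Obtain a basis $\bar{\mathcal C}$ for $\mathrm{Im}\,d^{i-1}$ with regard to $\mathcal{B}_i$ from the first $l$ columns of $Q_{i-1}^{-1}$; obtain a basis $\bar{\mathcal D}$ for $\mathrm{Ker}\,d^i$ with regard to $\mathcal{B}_i$ from the last $r-k$ rows of $P_i$; select those $r-k-l$ elements in $\bar{\mathcal D}$ which are not linear combinations of the elements in $\bar{\mathcal C}$, forming $\bar{\mathcal B}$; and lift $\bar{\mathcal B}$ to $\mathcal{B}$ by means of the injection $K$. Output: by juxtaposition, $\mathcal{B}\cup\mathcal{E}$ is a basis for $i$-cocycles over $G$.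
   Context: $\bar B(\mathbb{Z}[G])$ is the reduced bar construction of $G$, i.e. the reduced complex associated to the standard bar resolution; $\bar B_n(\mathbb{Z}[G])$ is generated by the symbols $[g_1,\dots,g_n]$, $g_j\in G$. An $n$-cochain in $\mathrm{Hom}(\bar B(\mathbb{Z}[G]),\mathbb{Z}_2)$ is given by a function $f$ on such symbols with values in $\mathbb{Z}_2$, with codifferential $$(\delta f)([h_1,\dots,h_{n+1}])=f([h_2,\dots,h_{n+1}])+\sum_{j=1}^{n}f([h_1,\dots,h_jh_{j+1},\dots,h_{n+1}])+f([h_1,\dots,h_n]) \pmod 2 .$$ The $i$-coboundary associated to an $(i-1)$-cochain $f$ is $\delta f$; an $i$-cocycle over $G$ is an $i$-cochain $f$ with $\delta f=0$. A basis for representative $i$-cocycles is a set of $i$-cocycles whose cohomology classes form a basis of $H^i(G;\mathbb{Z}_2)$. Identifying $\mathbb{Z}_2$ with $\{\pm1\}$, $i$-cocycles $\psi$ give the $i$-dimensional $i$-cocyclic matrices $(\psi(g_{j_1},\dots,g_{j_i}))$ over $G$, which the algorithm serves to compute. A contraction from a cochain complex $N$ to a cochain complex $M$ is a special type of homotopy equivalence: cochain maps $F:N\to M$ (projection) and $K:M\to N$ (injection) and a homotopy $\phi:N\to N$ of degree $-1$ such that $FK=1_M$, $1_N-KF=d_N\phi+\phi d_N$, $F\phi=0$, $\phi K=0$, $\phi\phi=0$. A cohomological model for $G$ is a contraction from $\mathrm{Hom}(\bar B(\mathbb{Z}[G]),\mathbb{Z}_2)$ to a differential graded comodule of finite type 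$cohG$.
   Formalization: The basis of Im d^{i-1} uses the first l rows (not columns) of Q_{i-1}^{-1}; the r-k-l selected elements are independent of C-bar and of each other; row reduction is Gaussian elimination with each row kept attached to its coboundary. The literal versions fail. *)

theory Defs
  imports "Jordan_Normal_Form.VS_Connect" "HOL-Algebra.AbelCoset" "HOL-Library.Z2"
begin

abbreviation Z2 :: "bit ring" where
  "Z2 \<equiv> class_ring"

section \<open>Cochain complexes over the field with two elements\<close>

locale cochain_complex =
  fixes V :: "nat \<Rightarrow> (bit, 'v) module"
    and d :: "nat \<Rightarrow> 'v \<Rightarrow> 'v"
  assumes d_linear: "linear_map Z2 (V n) (V (Suc n)) (d n)"
    and d_d: "x \<in> carrier (V n) \<Longrightarrow> d (Suc n) (d n x) = \<zero>\<^bsub>V (Suc (Suc n))\<^esub>"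

text \<open>
  The complexes are concentrated in degrees \<open>\<ge> 0\<close>, and \<open>\<phi> n\<close> is the component
  \<open>N (Suc n) \<rightarrow> N n\<close> of the homotopy; its component on \<open>N 0\<close> has target \<open>0\<close>, which is why the
  homotopy identity has only one term in degree \<open>0\<close>.
\<close>

locale contraction =
  N: cochain_complex N dN + M: cochain_complex M dM
  for N :: "nat \<Rightarrow> (bit, 'n) module" and dN
    and M :: "nat \<Rightarrow> (bit, 'm) module" and dM +
  fixes F :: "nat \<Rightarrow> 'n \<Rightarrow> 'm"
    and K :: "nat \<Rightarrow> 'm \<Rightarrow> 'n"
    and \<phi> :: "nat \<Rightarrow> 'n \<Rightarrow> 'n"
  assumes F_linear: "linear_map Z2 (N n) (M n) (F n)"
    and F_cochain: "x \<in> carrier (N n) \<Longrightarrow> F (Suc n) (dN n x) = dM n (F n x)"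
    and K_linear: "linear_map Z2 (M n) (N n) (K n)"
    and K_cochain: "y \<in> carrier (M n) \<Longrightarrow> K (Suc n) (dM n y) = dN n (K n y)"
    and phi_linear: "linear_map Z2 (N (Suc n)) (N n) (\<phi> n)"
    and F_K: "y \<in> carrier (M n) \<Longrightarrow> F n (K n y) = y"
    and homotopy_0: "x \<in> carrier (N 0) \<Longrightarrow> x \<ominus>\<^bsub>N 0\<^esub> K 0 (F 0 x) = \<phi> 0 (dN 0 x)"
    and homotopy_Suc: "x \<in> carrier (N (Suc n)) \<Longrightarrow>
      x \<ominus>\<^bsub>N (Suc n)\<^esub> K (Suc n) (F (Suc n) x)
        = dN n (\<phi> n x) \<oplus>\<^bsub>N (Suc n)\<^esub> \<phi> (Suc n) (dN (Suc n) x)"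
    and F_phi: "x \<in> carrier (N (Suc n)) \<Longrightarrow> F n (\<phi> n x) = \<zero>\<^bsub>M n\<^esub>"
    and phi_K: "y \<in> carrier (M (Suc n)) \<Longrightarrow> \<phi> n (K (Suc n) y) = \<zero>\<^bsub>N n\<^esub>"
    and phi_phi: "x \<in> carrier (N (Suc (Suc n))) \<Longrightarrow> \<phi> n (\<phi> (Suc n) x) = \<zero>\<^bsub>N n\<^esub>"

definition cocycles :: "(nat \<Rightarrow> (bit, 'v) module) \<Rightarrow> (nat \<Rightarrow> 'v \<Rightarrow> 'v) \<Rightarrow> nat \<Rightarrow> 'v set" where
  "cocycles V d i = {x \<in> carrier (V i). d i x = \<zero>\<^bsub>V (Suc i)\<^esub>}"

definition coboundaries :: "(nat \<Rightarrow> (bit, 'v) module) \<Rightarrow> (nat \<Rightarrow> 'v \<Rightarrow> 'v) \<Rightarrow> nat \<Rightarrow> 'v set" where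
  "coboundaries V d i = (if i = 0 then {\<zero>\<^bsub>V 0\<^esub>} else d (i - 1) ` carrier (V (i - 1)))"

definition subspace_basis :: "(bit, 'v) module \<Rightarrow> 'v set \<Rightarrow> 'v set \<Rightarrow> bool" where
  "subspace_basis V W A \<longleftrightarrow> vectorspace.basis Z2 (V\<lparr>carrier := W\<rparr>) A"

text \<open>The fields \<open>mult\<close> and \<open>one\<close> of a module record carry no meaning.\<close>

definition quotient_space :: "(bit, 'v) module \<Rightarrow> 'v set \<Rightarrow> (bit, 'v set) module" where
  "quotient_space V W =
    \<lparr>carrier = a_rcosets\<^bsub>V\<^esub> W, mult = (\<lambda>_ _. W), one = W, zero = W, add = set_add V,
     smult = (\<lambda>c X. \<Union>x\<in>X. W +>\<^bsub>V\<^esub> (c \<odot>\<^bsub>V\<^esub> x))\<rparr>"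

definition cohomology :: "(nat \<Rightarrow> (bit, 'v) module) \<Rightarrow> (nat \<Rightarrow> 'v \<Rightarrow> 'v) \<Rightarrow> nat \<Rightarrow> (bit, 'v set) module" where
  "cohomology V d i = quotient_space ((V i)\<lparr>carrier := cocycles V d i\<rparr>) (coboundaries V d i)"

definition cohomology_class :: "(nat \<Rightarrow> (bit, 'v) module) \<Rightarrow> (nat \<Rightarrow> 'v \<Rightarrow> 'v) \<Rightarrow> nat \<Rightarrow> 'v \<Rightarrow> 'v set" where
  "cohomology_class V d i x = coboundaries V d i +>\<^bsub>V i\<^esub> x"

definition representative_cocycle_basis ::
    "(nat \<Rightarrow> (bit, 'v) module) \<Rightarrow> (nat \<Rightarrow> 'v \<Rightarrow> 'v) \<Rightarrow> nat \<Rightarrow> 'v set \<Rightarrow> bool" where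
  "representative_cocycle_basis V d i B \<longleftrightarrow>
    B \<subseteq> cocycles V d i \<and> inj_on (cohomology_class V d i) B \<and>
    vectorspace.basis Z2 (cohomology V d i) (cohomology_class V d i ` B)"

section \<open>The cochain complex of the reduced bar construction\<close>

definition symbols :: "('g, 'b) monoid_scheme \<Rightarrow> nat \<Rightarrow> 'g list set" where
  "symbols G n = {gs. length gs = n \<and> set gs \<subseteq> carrier G}"

text \<open>
  The symbols are a free basis of the bar construction in degree \<open>n\<close> (which is not normalised), so
  a homomorphism to \<open>Z2\<close> is an arbitrary function on them.
\<close>

definition cochains :: "('g, 'b) monoid_scheme \<Rightarrow> nat \<Rightarrow> (bit, 'g list \<Rightarrow> bit) module" where
  "cochains G n = ring.func_space Z2 (symbols G n)"

text \<open>\<open>[h\<^sub>1, \<dots>, h\<^sub>j h\<^sub>j\<^sub>+\<^sub>1, \<dots>, h\<^sub>n\<^sub>+\<^sub>1]\<close>, where list positions start at \<open>0\<close> but \<open>j\<close> at \<open>1\<close>.\<close>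

definition merge :: "('g, 'b) monoid_scheme \<Rightarrow> nat \<Rightarrow> 'g list \<Rightarrow> 'g list" where
  "merge G j hs = take (j - 1) hs @ [(hs ! (j - 1)) \<otimes>\<^bsub>G\<^esub> (hs ! j)] @ drop (j + 1) hs"

definition codifferential ::
    "('g, 'b) monoid_scheme \<Rightarrow> nat \<Rightarrow> ('g list \<Rightarrow> bit) \<Rightarrow> 'g list \<Rightarrow> bit" where
  "codifferential G n f =
    (\<lambda>hs \<in> symbols G (Suc n). f (tl hs) + (\<Sum>j = 1..n. f (merge G j hs)) + f (butlast hs))"

text \<open>
  Over the ground field a differential graded comodule is just a cochain complex; finite type means
  finite dimension in each degree.
\<close>

locale cohomological_model =
  group G + contraction "cochains G" "codifferential G" M d F K \<phi>
  for G :: "('g, 'b) monoid_scheme" (structure)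
    and M :: "nat \<Rightarrow> (bit, 'm) module" and d F K \<phi> +
  assumes finite_type: "vectorspace.fin_dim Z2 (M n)"

section \<open>Step 1\<close>

definition characteristic_map :: "('g, 'b) monoid_scheme \<Rightarrow> 'g list \<Rightarrow> 'g list \<Rightarrow> bit" where
  "characteristic_map G gs = (\<lambda>hs \<in> symbols G (length gs). if hs = gs then 1 else 0)"

definition elementary_coboundary :: "('g, 'b) monoid_scheme \<Rightarrow> 'g list \<Rightarrow> 'g list \<Rightarrow> bit" where
  "elementary_coboundary G gs = codifferential G (length gs) (characteristic_map G gs)"

definition enumerates :: "'a list \<Rightarrow> 'a set \<Rightarrow> bool" where
  "enumerates xs A \<longleftrightarrow> distinct xs \<and> set xs = A"

text \<open>
  \<open>rs\<close> and \<open>cs\<close> list the symbols of degree \<open>i - 1\<close> and \<open>i\<close> in the orders in which they label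
  the rows and columns.
\<close>

definition coboundary_matrix ::
    "('g, 'b) monoid_scheme \<Rightarrow> nat \<Rightarrow> nat \<Rightarrow> 'g list list \<Rightarrow> 'g list list \<Rightarrow> bit mat" where
  "coboundary_matrix G t i rs cs =
    mat (4 ^ (i - 1) * t ^ (i - 1)) (4 ^ i * t ^ i)
      (\<lambda>(a, b). elementary_coboundary G (rs ! a) (cs ! b))"

definition eliminate :: "bit mat \<Rightarrow> nat \<Rightarrow> nat \<Rightarrow> nat set \<Rightarrow> bit mat" where
  "eliminate A p c T = mat (dim_row A) (dim_col A)
    (\<lambda>(a, b). if a \<in> T then A $$ (a, b) + A $$ (a, c) * A $$ (p, b) else A $$ (a, b))"

text \<open>
  Gaussian elimination, with any choice of pivots: a pivot row \<open>p\<close>, not used before, with entry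
  \<open>1\<close> in column \<open>c\<close> is used to clear this column in all rows that have not served as pivot row and,
  at will, in some of those that have (so both echelon and reduced echelon forms are covered).
  Rows are not physically interchanged: each row stays attached to the coboundary it came from, so
  that it makes sense to speak of the transformed row of a coboundary, and the result is in echelon
  form up to the order of its rows. The third argument of \<open>elimination\<close> collects the pivot rows.
\<close>

inductive elimination :: "bit mat \<Rightarrow> bit mat \<Rightarrow> nat set \<Rightarrow> bool" for C where
  start: "elimination C C {}"
| pivot: "elimination C A S \<Longrightarrow> p < dim_row A \<Longrightarrow> p \<notin> S \<Longrightarrow> c < dim_col A \<Longrightarrow> A $$ (p, c) = 1 \<Longrightarrow>
    {..<dim_row A} - insert p S \<subseteq> T \<Longrightarrow> p \<notin> T \<Longrightarrow>
    elimination C (eliminate A p c T) (insert p S)"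

definition row_reduction :: "bit mat \<Rightarrow> bit mat \<Rightarrow> bool" where
  "row_reduction C R \<longleftrightarrow>
    (\<exists>S. elimination C R S \<and> (\<forall>a<dim_row R. a \<notin> S \<longrightarrow> row R a = 0\<^sub>v (dim_col R)))"

definition coboundary_step ::
    "('g, 'b) monoid_scheme \<Rightarrow> nat \<Rightarrow> nat \<Rightarrow> 'g list list \<Rightarrow> 'g list list \<Rightarrow> ('g list \<Rightarrow> bit) set \<Rightarrow> bool" where
  "coboundary_step G t i rs cs E \<longleftrightarrow>
    (\<exists>R. row_reduction (coboundary_matrix G t i rs cs) R \<and>
         E = {elementary_coboundary G (rs ! a) | a. a < dim_row R \<and> row R a \<noteq> 0\<^sub>v (dim_col R)})"

section \<open>Step 2\<close>

definition ordered_basis :: "(bit, 'v) module \<Rightarrow> 'v list \<Rightarrow> bool" where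
  "ordered_basis V us \<longleftrightarrow> distinct us \<and> vectorspace.basis Z2 V (set us)"

definition from_coordinates :: "(bit, 'v) module \<Rightarrow> 'v list \<Rightarrow> bit vec \<Rightarrow> 'v" where
  "from_coordinates V us v = (\<Oplus>\<^bsub>V\<^esub>j\<in>{..<length us}. (v $ j) \<odot>\<^bsub>V\<^esub> (us ! j))"

text \<open>Matrices of linear maps have the images of the basis elements as rows.\<close>

definition matrix_of_map ::
    "(bit, 'w) module \<Rightarrow> ('v \<Rightarrow> 'w) \<Rightarrow> 'v list \<Rightarrow> 'w list \<Rightarrow> bit mat \<Rightarrow> bool" where
  "matrix_of_map W f us ws A \<longleftrightarrow>
    A \<in> carrier_mat (length us) (length ws) \<and>
    (\<forall>j<length us. f (us ! j) = from_coordinates W ws (row A j))"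

definition smith_diagonal :: "nat \<Rightarrow> nat \<Rightarrow> nat \<Rightarrow> bit mat" where
  "smith_diagonal m n l = mat m n (\<lambda>(a, b). if a = b \<and> a < l then 1 else 0)"

definition smith_normal_form :: "bit mat \<Rightarrow> bit mat \<Rightarrow> bit mat \<Rightarrow> nat \<Rightarrow> bool" where
  "smith_normal_form A P Q l \<longleftrightarrow>
    l \<le> min (dim_row A) (dim_col A) \<and>
    P \<in> carrier_mat (dim_row A) (dim_row A) \<and> invertible_mat P \<and>
    Q \<in> carrier_mat (dim_col A) (dim_col A) \<and> invertible_mat Q \<and>
    smith_diagonal (dim_row A) (dim_col A) l = P * A * Q"

text \<open>
  As \<open>D = P * A * Q\<close> and the images span the row space of \<open>A\<close>, the first \<open>l\<close> vectors of the
  change of basis given by \<open>Q\<^sup>-\<^sup>1\<close> are the first \<open>l\<close> \<^emph>\<open>rows\<close> of that matrix under the row convention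
  used here.
\<close>

definition smith_step ::
    "(nat \<Rightarrow> (bit, 'm) module) \<Rightarrow> (nat \<Rightarrow> 'm \<Rightarrow> 'm) \<Rightarrow> nat \<Rightarrow> 'm list \<Rightarrow> 'm list \<Rightarrow> 'm list \<Rightarrow>
      'm set \<Rightarrow> 'm set \<Rightarrow> nat \<Rightarrow> bool" where
  "smith_step M d i us es vs Cbar Dbar n \<longleftrightarrow>
    (\<exists>A A' P Q Qinv P' Q' l k.
      matrix_of_map (M i) (d (i - 1)) us es A \<and>
      matrix_of_map (M (Suc i)) (d i) es vs A' \<and>
      smith_normal_form A P Q l \<and>
      smith_normal_form A' P' Q' k \<and>
      Qinv \<in> carrier_mat (length es) (length es) \<and> inverts_mat Q Qinv \<and> inverts_mat Qinv Q \<and>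
      Cbar = {from_coordinates (M i) es (row Qinv j) | j. j < l} \<and>
      Dbar = {from_coordinates (M i) es (row P' j) | j. k \<le> j \<and> j < length es} \<and>
      n = length es - k - l)"

text \<open>
  The elements are selected independently of \<open>Cbar\<close> \<^emph>\<open>and of one another\<close>: an element depending on
  \<open>Cbar\<close> and other selected ones would be redundant.
\<close>

definition selection_step :: "(bit, 'm) module \<Rightarrow> 'm set \<Rightarrow> 'm set \<Rightarrow> nat \<Rightarrow> 'm set \<Rightarrow> bool" where
  "selection_step V Cbar Dbar n Bbar \<longleftrightarrow>
    Bbar \<subseteq> Dbar \<and> card Bbar = n \<and>
    (\<forall>b\<in>Bbar. b \<notin> LinearCombinations.module.span Z2 V (Cbar \<union> (Bbar - {b})))"

end

(*
  Over the field with two elements, a finite family is a basis of a subspace when its linear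
  combinations sweep out the subspace and vanish only for zero coefficients.

  Step 1: Restricted to the pivot columns, the rows of the coboundary matrix that have served as
  pivot rows stay independent while the other rows of the current matrix vanish, so the pivot rows
  are exactly the rows that end up nonzero, and the corresponding original rows form a basis of the
  row space.

  Step 2: With D = P A Q, the rows of P and of Q^-1 are new bases in which the codifferential sends
  the j-th source vector to the j-th target vector for j < l and to zero otherwise; this yields
  bases of image and kernel.  Counting dimensions, every admissible selection completes the basis of
  coboundaries to one of cocycles in cohG.  Such a selection spans a complement of the coboundaries
  in the cocycles, a property that K carries to the bar complex: a cocycle z equals
  K F z + delta phi z, and if K b is a coboundary then so is b = F K b.
*)

theory Submission
  imports Defs "Jordan_Normal_Form.Column_Operations"
begin

section \<open>Linear combinations of indexed families\<close>

text \<open>Two rows of a matrix may a priori be the same vector, so a set of rows cannot be counted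
  reliably. The linear algebra therefore runs on indexed families, where independence concerns
  coefficients at indices. Injectivity of the family is then a consequence, and only afterwards does
  its image become a basis in the library's sense. A complement of the coboundaries in the cocycles
  is expressed by linear combinations modulo a subspace. In this form the count in
  \<open>cohG\<close> delivers it, \<open>K\<close> carries it over by direct computation, and it
  can be combined with any basis of the coboundaries of the bar complex. This matters because
  \<open>Cbar\<close> and \<open>E\<close> live in different complexes and are found independently
  of each other. The steps of the method are relations that leave choices open. Correctness is shown
  for every outcome, and separate existence proofs for elimination, Smith forms and selection ensure
  that there is an outcome.\<close>

definition lin_comb :: "('k, 'v) module \<Rightarrow> 'i set \<Rightarrow> ('i \<Rightarrow> 'v) \<Rightarrow> ('i \<Rightarrow> 'k) \<Rightarrow> 'v" where
  "lin_comb V I x a = (\<Oplus>\<^bsub>V\<^esub>i\<in>I. a i \<odot>\<^bsub>V\<^esub> x i)"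

text \<open>Coefficients are total functions, and only their values on \<open>I\<close> are
  constrained. Requiring the range to equal \<open>W\<close> gives both containments of spanning at
  once.\<close>

definition basis_family :: "('k::zero, 'v) module \<Rightarrow> 'v set \<Rightarrow> 'i set \<Rightarrow> ('i \<Rightarrow> 'v) \<Rightarrow> bool" where
  "basis_family V W I x \<longleftrightarrow> range (lin_comb V I x) = W \<and>
    (\<forall>a. lin_comb V I x a = \<zero>\<^bsub>V\<^esub> \<longrightarrow> (\<forall>i\<in>I. a i = 0))"

text \<open>With \<open>class_ring\<close> the scalars are all elements of a type, so carrier
  conditions on coefficients disappear and sums of coefficients are ordinary sums.\<close>

locale field_space = vectorspace class_ring V for V :: "('k::field, 'v) module"
begin

lemma smult_closed' [simp, intro]: "v \<in> carrier V \<Longrightarrow> c \<odot>\<^bsub>V\<^esub> v \<in> carrier V"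
  using smult_closed by simp

lemma smult_class_ring:
  assumes "v \<in> carrier V"
  shows "(a * b) \<odot>\<^bsub>V\<^esub> v = a \<odot>\<^bsub>V\<^esub> (b \<odot>\<^bsub>V\<^esub> v)"
    and "(a + b) \<odot>\<^bsub>V\<^esub> v = a \<odot>\<^bsub>V\<^esub> v \<oplus>\<^bsub>V\<^esub> b \<odot>\<^bsub>V\<^esub> v"
    and "1 \<odot>\<^bsub>V\<^esub> v = v"
    and "w \<in> carrier V \<Longrightarrow> a \<odot>\<^bsub>V\<^esub> (v \<oplus>\<^bsub>V\<^esub> w) = a \<odot>\<^bsub>V\<^esub> v \<oplus>\<^bsub>V\<^esub> a \<odot>\<^bsub>V\<^esub> w"
  using assms smult_assoc1[of a b v] smult_l_distr[of a b v] smult_one[of v] smult_r_distr[of a v w] by simp_all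

lemma lin_comb_closed [simp, intro]: "x \<in> I \<rightarrow> carrier V \<Longrightarrow> lin_comb V I x a \<in> carrier V"
  unfolding lin_comb_def by (rule finsum_closed) auto

lemma lin_comb_cong:
  assumes "x \<in> I \<rightarrow> carrier V" "\<And>i. i \<in> I \<Longrightarrow> x i = y i" "\<And>i. i \<in> I \<Longrightarrow> a i = b i"
  shows "lin_comb V I x a = lin_comb V I y b"
  unfolding lin_comb_def by (rule finsum_cong') (use assms in \<open>auto simp: Pi_def\<close>)

lemma lin_comb_empty [simp]: "lin_comb V {} x a = \<zero>\<^bsub>V\<^esub>"
  by (simp add: lin_comb_def)

lemma lin_comb_insert:
  assumes "finite I" "j \<notin> I" "x \<in> insert j I \<rightarrow> carrier V"
  shows "lin_comb V (insert j I) x a = a j \<odot>\<^bsub>V\<^esub> x j \<oplus>\<^bsub>V\<^esub> lin_comb V I x a"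
  unfolding lin_comb_def by (rule finsum_insert) (use assms in auto)

lemma lin_comb_zero:
  assumes "x \<in> I \<rightarrow> carrier V" "\<And>i. i \<in> I \<Longrightarrow> a i = 0"
  shows "lin_comb V I x a = \<zero>\<^bsub>V\<^esub>"
proof -
  have "lin_comb V I x a = (\<Oplus>\<^bsub>V\<^esub>i\<in>I. \<zero>\<^bsub>V\<^esub>)"
    unfolding lin_comb_def using assms lmult_0 by (intro finsum_cong') auto
  then show ?thesis by simp
qed

lemma lin_comb_add:
  assumes "x \<in> I \<rightarrow> carrier V"
  shows "lin_comb V I x (\<lambda>i. a i + b i) = lin_comb V I x a \<oplus>\<^bsub>V\<^esub> lin_comb V I x b"
proof -
  have "lin_comb V I x (\<lambda>i. a i + b i) = (\<Oplus>\<^bsub>V\<^esub>i\<in>I. a i \<odot>\<^bsub>V\<^esub> x i \<oplus>\<^bsub>V\<^esub> b i \<odot>\<^bsub>V\<^esub> x i)"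
    unfolding lin_comb_def using assms smult_l_distr by (intro finsum_cong') (auto simp: Pi_def)
  also have "\<dots> = lin_comb V I x a \<oplus>\<^bsub>V\<^esub> lin_comb V I x b"
    unfolding lin_comb_def using assms by (intro finsum_addf) auto
  finally show ?thesis .
qed

lemma lin_comb_smult:
  assumes "finite I" "x \<in> I \<rightarrow> carrier V"
  shows "lin_comb V I x (\<lambda>i. c * a i) = c \<odot>\<^bsub>V\<^esub> lin_comb V I x a"
proof -
  have "lin_comb V I x (\<lambda>i. c * a i) = (\<Oplus>\<^bsub>V\<^esub>i\<in>I. c \<odot>\<^bsub>V\<^esub> (a i \<odot>\<^bsub>V\<^esub> x i))"
    unfolding lin_comb_def using assms smult_assoc1 by (intro finsum_cong') (auto simp: Pi_def)
  also have "\<dots> = c \<odot>\<^bsub>V\<^esub> lin_comb V I x a"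
    unfolding lin_comb_def using assms by (intro finsum_smult_ldistr[symmetric]) auto
  finally show ?thesis .
qed

lemma lin_comb_union:
  assumes "finite I" "finite J" "I \<inter> J = {}" "x \<in> I \<union> J \<rightarrow> carrier V"
  shows "lin_comb V (I \<union> J) x a = lin_comb V I x a \<oplus>\<^bsub>V\<^esub> lin_comb V J x a"
  unfolding lin_comb_def by (rule finsum_Un_disjoint) (use assms in auto)

lemma lin_comb_reindex:
  assumes "inj_on f J" "x \<in> f ` J \<rightarrow> carrier V"
  shows "lin_comb V (f ` J) x a = lin_comb V J (\<lambda>j. x (f j)) (\<lambda>j. a (f j))"
  unfolding lin_comb_def by (rule finsum_reindex) (use assms in auto)

lemma lin_comb_unit:
  assumes "finite I" "j \<in> I" "x \<in> I \<rightarrow> carrier V"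
  shows "lin_comb V I x (\<lambda>i. if i = j then 1 else 0) = x j"
proof -
  have I: "I = insert j (I - {j})" using assms by auto
  have "lin_comb V (I - {j}) x (\<lambda>i. if i = j then 1 else 0) = \<zero>\<^bsub>V\<^esub>"
    by (rule lin_comb_zero) (use assms in auto)
  then show ?thesis
    using lin_comb_insert[of "I - {j}" j x "\<lambda>i. if i = j then 1 else 0"] assms I smult_one[of "x j"]
    by auto
qed

lemma lin_comb_mono:
  assumes "finite J" "I \<subseteq> J" "x \<in> J \<rightarrow> carrier V"
  shows "lin_comb V J x (\<lambda>i. if i \<in> I then a i else 0) = lin_comb V I x a"
proof -
  have J: "J = I \<union> (J - I)" using assms by auto
  have "lin_comb V (J - I) x (\<lambda>i. if i \<in> I then a i else 0) = \<zero>\<^bsub>V\<^esub>"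
    by (rule lin_comb_zero) (use assms in auto)
  moreover have "lin_comb V I x (\<lambda>i. if i \<in> I then a i else 0) = lin_comb V I x a"
    by (rule lin_comb_cong) (use assms in auto)
  moreover have "finite I" using assms finite_subset by auto
  moreover have "x \<in> I \<rightarrow> carrier V" using assms by auto
  ultimately show ?thesis
    using lin_comb_union[of I "J - I" x "\<lambda>i. if i \<in> I then a i else 0"] assms J
    by (metis Diff_disjoint finite_Diff lin_comb_closed r_zero)
qed

text \<open>The new coefficients are the row vector \<open>a\<close> times the matrix
  \<open>A\<close>; through this lemma products of matrices enter the computations with
  vectors.\<close>

lemma lin_comb_lin_comb:
  assumes "finite I" "finite J" "x \<in> I \<rightarrow> carrier V"
  shows "lin_comb V J (\<lambda>j. lin_comb V I x (A j)) a = lin_comb V I x (\<lambda>i. \<Sum>j\<in>J. a j * A j i)"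
  using assms(2)
proof induction
  case empty
  then show ?case using lin_comb_zero[of x I "\<lambda>i. 0"] assms by simp
next
  case (insert j J)
  then have "lin_comb V (insert j J) (\<lambda>j. lin_comb V I x (A j)) a
      = a j \<odot>\<^bsub>V\<^esub> lin_comb V I x (A j) \<oplus>\<^bsub>V\<^esub> lin_comb V J (\<lambda>j. lin_comb V I x (A j)) a"
    using assms by (intro lin_comb_insert) auto
  also have "\<dots> = lin_comb V I x (\<lambda>i. a j * A j i + (\<Sum>j\<in>J. a j * A j i))"
    using assms by (simp add: insert.IH lin_comb_add lin_comb_smult)
  finally show ?case using insert.hyps by simp
qed

lemma lincomb_eq_lin_comb: "lincomb a A = lin_comb V A (\<lambda>v. v) a"
  by (simp add: lincomb_def lin_comb_def)

lemma basis_family_indep: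
  assumes "basis_family V W I x" "lin_comb V I x a = \<zero>\<^bsub>V\<^esub>" "i \<in> I"
  shows "a i = 0"
  using assms unfolding basis_family_def by blast

lemma basis_family_closed:
  assumes "basis_family V W I x" "finite I" "x \<in> I \<rightarrow> carrier V"
  shows "x \<in> I \<rightarrow> W"
  using lin_comb_unit[OF assms(2) _ assms(3)] assms(1)
  unfolding basis_family_def by (metis (no_types, lifting) Pi_I rangeI)

text \<open>The bridge to the library's notion of basis. Span and independence of a subset of
  \<open>W\<close> are the same in \<open>W\<close> and in \<open>V\<close>, so coefficients in
  \<open>V\<close> can decide both.\<close>

lemma basis_vs_iff:
  assumes W: "subspace class_ring W V" and A: "finite A"
  shows "vectorspace.basis class_ring (vs W) A \<longleftrightarrow> A \<subseteq> W \<and> basis_family V W A (\<lambda>v. v)"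
proof (cases "A \<subseteq> W")
  case False
  then show ?thesis
    using vectorspace.basis_def[OF subspace_is_vs[OF W]] by auto
next
  case True
  have sm: "submodule class_ring W V" using W by (rule is_module)
  have WV: "W \<subseteq> carrier V" using sm by (simp add: submodule.subset)
  have AV: "A \<subseteq> carrier V" using True WV by auto
  have "vectorspace.basis class_ring (vs W) A \<longleftrightarrow> lin_indpt A \<and> span A = W"
    using vectorspace.basis_def[OF subspace_is_vs[OF W]]
      span_li_not_depend[OF True sm] True by auto
  moreover have "span A = range (lin_comb V A (\<lambda>v. v))"
    using finite_span[OF A AV] by (auto simp: lincomb_eq_lin_comb)
  moreover have "lin_indpt A \<longleftrightarrow> (\<forall>a. lin_comb V A (\<lambda>v. v) a = \<zero>\<^bsub>V\<^esub> \<longrightarrow> (\<forall>i\<in>A. a i = 0))"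
  proof
    assume "lin_indpt A"
    then show "\<forall>a. lin_comb V A (\<lambda>v. v) a = \<zero>\<^bsub>V\<^esub> \<longrightarrow> (\<forall>i\<in>A. a i = 0)"
      using lin_dep_crit[OF A subset_refl] by (auto simp: lincomb_eq_lin_comb)
  next
    assume "\<forall>a. lin_comb V A (\<lambda>v. v) a = \<zero>\<^bsub>V\<^esub> \<longrightarrow> (\<forall>i\<in>A. a i = 0)"
    then show "lin_indpt A"
      using finite_lin_indpt2[OF A AV] by (auto simp: lincomb_eq_lin_comb)
  qed
  ultimately show ?thesis using True by (auto simp: basis_family_def)
qed

text \<open>If \<open>x i = x j\<close>, the difference of the unit coefficient functions at
  \<open>i\<close> and \<open>j\<close> gives the zero vector, so it must vanish at
  \<open>i\<close>, which forces \<open>i = j\<close>.\<close>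

lemma basis_family_inj_on:
  assumes "basis_family V W I x" "finite I" "x \<in> I \<rightarrow> carrier V"
  shows "inj_on x I"
proof
  fix i j assume ij: "i \<in> I" "j \<in> I" "x i = x j"
  let ?u = "\<lambda>j i. if i = j then 1 else 0 :: 'k"
  have "lin_comb V I x (\<lambda>k. ?u i k + (-1) * ?u j k) = x i \<oplus>\<^bsub>V\<^esub> (-1) \<odot>\<^bsub>V\<^esub> x i"
    using assms(2,3) ij by (simp only: lin_comb_add lin_comb_smult lin_comb_unit)
  also have "\<dots> = \<zero>\<^bsub>V\<^esub>"
    using ij assms(3) smult_l_distr[of 1 "-1" "x i"] lmult_0[of "x i"] smult_one[of "x i"] by auto
  finally have "?u i i + (-1) * ?u j i = 0" by (rule basis_family_indep[OF assms(1) _ ij(1)])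
  then show "i = j" by (auto split: if_splits)
qed

lemma basis_family_image:
  assumes "inj_on x I" "x \<in> I \<rightarrow> carrier V"
  shows "basis_family V W (x ` I) (\<lambda>v. v) \<longleftrightarrow> basis_family V W I x"
proof -
  have lc: "lin_comb V (x ` I) (\<lambda>v. v) a = lin_comb V I x (\<lambda>i. a (x i))" for a
    using lin_comb_reindex[OF assms(1), of "\<lambda>v. v" a] assms(2) by auto
  have lc': "lin_comb V I x a = lin_comb V (x ` I) (\<lambda>v. v) (\<lambda>v. a (inv_into I x v))" for a
    unfolding lc by (rule lin_comb_cong) (use assms in auto)
  have "range (lin_comb V (x ` I) (\<lambda>v. v)) = range (lin_comb V I x)"
    using lc lc' by (metis (no_types, lifting) image_subset_iff rangeI subset_antisym)
  moreover have "(\<forall>a. lin_comb V (x ` I) (\<lambda>v. v) a = \<zero>\<^bsub>V\<^esub> \<longrightarrow> (\<forall>i\<in>x ` I. a i = 0)) \<longleftrightarrow>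
      (\<forall>a. lin_comb V I x a = \<zero>\<^bsub>V\<^esub> \<longrightarrow> (\<forall>i\<in>I. a i = 0))"
  proof (intro iffI allI impI ballI)
    fix a i assume h: "\<forall>a. lin_comb V (x ` I) (\<lambda>v. v) a = \<zero>\<^bsub>V\<^esub> \<longrightarrow> (\<forall>i\<in>x ` I. a i = 0)"
      "lin_comb V I x a = \<zero>\<^bsub>V\<^esub>" "i \<in> I"
    then have "a (inv_into I x (x i)) = 0" using lc' by auto
    then show "a i = 0" using h assms by simp
  next
    fix a v assume "\<forall>a. lin_comb V I x a = \<zero>\<^bsub>V\<^esub> \<longrightarrow> (\<forall>i\<in>I. a i = 0)"
      "lin_comb V (x ` I) (\<lambda>v. v) a = \<zero>\<^bsub>V\<^esub>" "v \<in> x ` I"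
    then show "a v = 0" unfolding lc by (metis (mono_tags, lifting) imageE)
  qed
  ultimately show ?thesis by (simp add: basis_family_def)
qed

lemma basis_family_iff:
  assumes "subspace class_ring W V" "finite I" "x \<in> I \<rightarrow> carrier V"
  shows "basis_family V W I x \<longleftrightarrow> inj_on x I \<and> vectorspace.basis class_ring (vs W) (x ` I)"
  using assms basis_family_image[of x I W] basis_vs_iff[of W "x ` I"]
    basis_family_inj_on[of W I x] basis_family_closed[of W I x] by auto

text \<open>The two inverse relations have separate roles: \<open>P'P\<close> recovers arbitrary
  coefficients and so gives spanning, while \<open>PP'\<close> undoes the effect of \<open>P\<close>
  on a vanishing combination and so gives independence.\<close>

lemma basis_family_change:
  fixes I :: "'i set"
  assumes x: "basis_family V W I x" "x \<in> I \<rightarrow> carrier V" and I: "finite I"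
    and PP': "\<And>i j. i \<in> I \<Longrightarrow> j \<in> I \<Longrightarrow> (\<Sum>k\<in>I. P i k * P' k j) = (if i = j then 1 else 0)"
    and P'P: "\<And>i j. i \<in> I \<Longrightarrow> j \<in> I \<Longrightarrow> (\<Sum>k\<in>I. P' i k * P k j) = (if i = j then 1 else 0)"
  shows "basis_family V W I (\<lambda>j. lin_comb V I x (P j))"
proof -
  \<comment> \<open>In row vector notation this is (aA)B = a(AB) = a.\<close>
  have inverse_coeff: "(\<Sum>j\<in>I. (\<Sum>k\<in>I. a k * A k j) * B j i) = a i"
    if "i \<in> I" and AB: "\<And>i j. i \<in> I \<Longrightarrow> j \<in> I \<Longrightarrow> (\<Sum>k\<in>I. A i k * B k j) = (if i = j then 1 else 0)"
    for a i and A B :: "'i \<Rightarrow> 'i \<Rightarrow> 'k"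
  proof -
    have "(\<Sum>j\<in>I. (\<Sum>k\<in>I. a k * A k j) * B j i) = (\<Sum>k\<in>I. \<Sum>j\<in>I. a k * (A k j * B j i))"
      by (subst sum.swap) (simp add: sum_distrib_right mult.assoc)
    also have "\<dots> = (\<Sum>k\<in>I. if k = i then a k else 0)"
      by (intro sum.cong refl) (simp add: sum_distrib_left[symmetric] AB that)
    also have "\<dots> = a i" using that I by simp
    finally show ?thesis .
  qed
  have lc: "lin_comb V I (\<lambda>j. lin_comb V I x (P j)) a = lin_comb V I x (\<lambda>i. \<Sum>j\<in>I. a j * P j i)" for a
    using lin_comb_lin_comb[OF I I x(2)] .
  have "lin_comb V I x a \<in> range (lin_comb V I (\<lambda>j. lin_comb V I x (P j)))" for a
  proof -
    have "lin_comb V I x a = lin_comb V I x (\<lambda>i. \<Sum>j\<in>I. (\<Sum>k\<in>I. a k * P' k j) * P j i)"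
      by (rule lin_comb_cong[OF x(2)]) (use inverse_coeff[OF _ P'P] in auto)
    then show ?thesis unfolding lc[symmetric] by blast
  qed
  then have "range (lin_comb V I (\<lambda>j. lin_comb V I x (P j))) = range (lin_comb V I x)"
    using lc by auto
  moreover have "a i = 0" if 0: "lin_comb V I (\<lambda>j. lin_comb V I x (P j)) a = \<zero>\<^bsub>V\<^esub>" and i: "i \<in> I" for a i
  proof -
    have "\<forall>i\<in>I. (\<Sum>j\<in>I. a j * P j i) = 0"
      using 0 x(1) unfolding lc basis_family_def by blast
    then have "(\<Sum>j\<in>I. (\<Sum>k\<in>I. a k * P k j) * P' j i) = 0" by simp
    then show ?thesis using inverse_coeff[OF i PP', of a] by simp
  qed
  ultimately show ?thesis using x(1) by (auto simp: basis_family_def)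
qed

end

lemma lin_comb_linear_map:
  fixes V :: "('k::field, 'v) module"
  assumes "linear_map class_ring V W T" "finite I" "x \<in> I \<rightarrow> carrier V"
  shows "T (lin_comb V I x a) = lin_comb W I (\<lambda>i. T (x i)) a"
proof -
  interpret linear_map class_ring V W T by fact
  interpret V: field_space V by unfold_locales
  interpret W: field_space W by unfold_locales
  show ?thesis
    using assms(2,3)
  proof (induction I)
    case (insert i I)
    then have "(\<lambda>i. T (x i)) \<in> insert i I \<rightarrow> carrier W" by auto
    then show ?case using insert by (simp add: V.lin_comb_insert W.lin_comb_insert)
  qed simp
qed

section \<open>Smith normal forms and adapted bases\<close>

lemma (in field_space) basis_family_subset_indep:
  assumes "basis_family V W J x" "finite J" "x \<in> J \<rightarrow> carrier V" "I \<subseteq> J"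
    and "lin_comb V I x a = \<zero>\<^bsub>V\<^esub>" "i \<in> I"
  shows "a i = 0"
proof -
  have "lin_comb V J x (\<lambda>i. if i \<in> I then a i else 0) = \<zero>\<^bsub>V\<^esub>"
    using lin_comb_mono[OF assms(2,4,3)] assms(5) by simp
  then have "(if i \<in> I then a i else 0) = 0"
    by (rule basis_family_indep[OF assms(1)]) (use assms in auto)
  then show ?thesis using assms by simp
qed

text \<open>In these bases \<open>T\<close> only truncates coordinates: it keeps the first
  \<open>l\<close> and forgets the rest. Hence the vectors \<open>y j\<close> with
  \<open>j < l\<close> carry the image, and the vectors \<open>x j\<close> with
  \<open>j >= l\<close> carry the kernel.\<close>

lemma adapted_bases:
  fixes V :: "('k::field, 'v) module" and W :: "('k, 'w) module" and n m :: nat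
  assumes T: "linear_map class_ring V W T"
    and x: "basis_family V (carrier V) {..<n} x" "x \<in> {..<n} \<rightarrow> carrier V"
    and y: "basis_family W (carrier W) {..<m} y" "y \<in> {..<m} \<rightarrow> carrier W"
    and l: "l \<le> n" "l \<le> m"
    and Tx: "\<And>j. j < n \<Longrightarrow> T (x j) = (if j < l then y j else \<zero>\<^bsub>W\<^esub>)"
  shows "basis_family W (T ` carrier V) {..<l} y"
    and "basis_family V {v \<in> carrier V. T v = \<zero>\<^bsub>W\<^esub>} {l..<n} x"
proof -
  interpret linear_map class_ring V W T by fact
  interpret V: field_space V by unfold_locales
  interpret W: field_space W by unfold_locales
  have n: "{..<n} = {..<l} \<union> {l..<n}" using l by auto
  have xl: "x \<in> {..<l} \<rightarrow> carrier V" "x \<in> {l..<n} \<rightarrow> carrier V" using x(2) n by auto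
  have yl: "y \<in> {..<l} \<rightarrow> carrier W" using y(2) l by auto
  have Tl: "T (lin_comb V {..<l} x a) = lin_comb W {..<l} y a" for a
    unfolding lin_comb_linear_map[OF T finite_lessThan xl(1)]
    using Tx l yl by (intro W.lin_comb_cong) auto
  have T0: "T (lin_comb V {l..<n} x a) = \<zero>\<^bsub>W\<^esub>" for a
  proof -
    have "T (lin_comb V {l..<n} x a) = lin_comb W {l..<n} (\<lambda>i. T (x i)) a"
      using lin_comb_linear_map[OF T _ xl(2)] by simp
    also have "\<dots> = lin_comb W {l..<n} (\<lambda>i. \<zero>\<^bsub>W\<^esub>) a"
      using Tx by (intro W.lin_comb_cong) auto
    also have "\<dots> = \<zero>\<^bsub>W\<^esub>"
      by (simp add: lin_comb_def W.module.rmult_0)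
    finally show ?thesis .
  qed
  have split: "lin_comb V {..<n} x a = lin_comb V {..<l} x a \<oplus>\<^bsub>V\<^esub> lin_comb V {l..<n} x a" for a
    unfolding n by (rule V.lin_comb_union) (use x(2) n in auto)
  have Tn: "T (lin_comb V {..<n} x a) = lin_comb W {..<l} y a" for a
    unfolding split using xl yl by (simp add: Tl T0)
  have V: "carrier V = range (lin_comb V {..<n} x)" using x(1) by (simp add: basis_family_def)
  have "T ` carrier V = range (lin_comb W {..<l} y)"
    unfolding V image_image Tn ..
  moreover have indep: "a i = 0" if "lin_comb W {..<l} y a = \<zero>\<^bsub>W\<^esub>" "i < l" for a i
    by (rule W.basis_family_subset_indep[OF y(1) _ y(2) _ that(1)]) (use that l in auto)
  ultimately show "basis_family W (T ` carrier V) {..<l} y"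
    by (auto simp: basis_family_def)
  have "{v \<in> carrier V. T v = \<zero>\<^bsub>W\<^esub>} = range (lin_comb V {l..<n} x)"
  proof (intro equalityI subsetI)
    fix v assume v: "v \<in> {v \<in> carrier V. T v = \<zero>\<^bsub>W\<^esub>}"
    then obtain a where a: "v = lin_comb V {..<n} x a" using V by auto
    \<comment> \<open>The independence of the target vectors kills the first \<open>l\<close>
      coefficients of a kernel element, so only the second summand of \<open>split\<close>
      survives.\<close>
    then have "lin_comb V {..<l} x a = \<zero>\<^bsub>V\<^esub>"
      using v Tn indep by (intro V.lin_comb_zero[OF xl(1)]) auto
    then show "v \<in> range (lin_comb V {l..<n} x)"
      using xl by (simp add: a split)
  qed (use T0 xl in auto)
  moreover have "a i = 0" if "lin_comb V {l..<n} x a = \<zero>\<^bsub>V\<^esub>" "i \<in> {l..<n}" for a i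
    by (rule V.basis_family_subset_indep[OF x(1) _ x(2) _ that(1)]) (use that in auto)
  ultimately show "basis_family V {v \<in> carrier V. T v = \<zero>\<^bsub>W\<^esub>} {l..<n} x"
    by (auto simp: basis_family_def)
qed

lemma (in field_space) basis_family_change_mat:
  assumes x: "basis_family V W {..<n} x" "x \<in> {..<n} \<rightarrow> carrier V"
    and P: "P \<in> carrier_mat n n" "P' \<in> carrier_mat n n" "P * P' = 1\<^sub>m n" "P' * P = 1\<^sub>m n"
  shows "basis_family V W {..<n} (\<lambda>j. lin_comb V {..<n} x (\<lambda>i. P $$ (j, i)))"
proof -
  have sum: "(\<Sum>k<n. A $$ (i, k) * B $$ (k, j)) = (if i = j then 1 else 0)"
    if "A \<in> carrier_mat n n" "B \<in> carrier_mat n n" "A * B = 1\<^sub>m n" "i \<in> {..<n}" "j \<in> {..<n}" for A B :: "'k mat" and i j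
  proof -
    have "(A * B) $$ (i, j) = (\<Sum>k<n. A $$ (i, k) * B $$ (k, j))"
      using that(1,2,4,5) by (simp add: scalar_prod_def atLeast0LessThan)
    then show ?thesis using that by simp
  qed
  show ?thesis
    by (rule basis_family_change[OF x _ sum[OF P(1,2,3)] sum[OF P(2,1,4)]]) auto
qed

lemma smith_diagonal_mult_index:
  assumes "B \<in> carrier_mat m m" "l \<le> m" "j < n" "k < m"
  shows "(smith_diagonal n m l * B) $$ (j, k) = (if j < l then B $$ (j, k) else 0)"
proof -
  have "(smith_diagonal n m l * B) $$ (j, k) = (\<Sum>i<m. (if j = i \<and> j < l then 1 else 0) * B $$ (i, k))"
    \<comment> \<open>Here and below, the deleted simplification rules would turn sums and products
      of bits into \<open>XOR\<close> and \<open>AND\<close>, where the laws for finite sums in a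
      ring no longer match.\<close>
    using assms by (simp add: smith_diagonal_def scalar_prod_def atLeast0LessThan del: add_bit_eq_xor mult_bit_eq_and)
  also have "\<dots> = (\<Sum>i<m. if i = j then (if j < l then B $$ (j, k) else 0) else 0)"
    by (rule sum.cong) (auto simp del: add_bit_eq_xor mult_bit_eq_and)
  also have "\<dots> = (if j < l then B $$ (j, k) else 0)" using assms by auto
  finally show ?thesis .
qed

text \<open>\<open>invertible_mat\<close> leaves the shape of the inverse open. It is read off by
  comparing the numbers of columns in the two inverse equations.\<close>

lemma invertible_mat_obtain:
  assumes "invertible_mat P" "P \<in> carrier_mat n n"
  obtains P' where "P' \<in> carrier_mat n n" "P * P' = 1\<^sub>m n" "P' * P = 1\<^sub>m n"
proof -
  obtain P' where P': "P * P' = 1\<^sub>m (dim_row P)" "P' * P = 1\<^sub>m (dim_row P')"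
    using assms(1) unfolding invertible_mat_def inverts_mat_def by auto
  have "dim_col P' = n" using arg_cong[OF P'(1), of dim_col] assms(2) by simp
  moreover have "dim_row P' = n" using arg_cong[OF P'(2), of dim_col] assms(2) by simp
  ultimately show ?thesis using that[of P'] P' assms(2) by auto
qed

text \<open>Row \<open>j\<close> of \<open>P * A\<close> lists the coordinates of
  \<open>T (x' j)\<close>. Cancelling \<open>Q\<close> in D = PAQ shows that this row is row
  \<open>j\<close> of \<open>Qinv\<close> for \<open>j < l\<close> and zero otherwise. This is why
  the source basis comes from \<open>P\<close> and the target basis from the inverse of
  \<open>Q\<close>.\<close>

lemma smith_adapted_bases:
  fixes V :: "(bit, 'v) module" and W :: "(bit, 'w) module" and n m :: nat
  assumes T: "linear_map Z2 V W T"
    and x: "basis_family V (carrier V) {..<n} x" "x \<in> {..<n} \<rightarrow> carrier V"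
    and y: "basis_family W (carrier W) {..<m} y" "y \<in> {..<m} \<rightarrow> carrier W"
    and A: "A \<in> carrier_mat n m"
    and TA: "\<And>j. j < n \<Longrightarrow> T (x j) = lin_comb W {..<m} y (\<lambda>k. A $$ (j, k))"
    and snf: "smith_normal_form A P Q l"
    and Qinv: "Qinv \<in> carrier_mat m m" "inverts_mat Q Qinv" "inverts_mat Qinv Q"
  defines "x' \<equiv> \<lambda>j. lin_comb V {..<n} x (\<lambda>i. P $$ (j, i))"
    and "y' \<equiv> \<lambda>j. lin_comb W {..<m} y (\<lambda>i. Qinv $$ (j, i))"
  shows "basis_family W (T ` carrier V) {..<l} y'"
    and "basis_family V {v \<in> carrier V. T v = \<zero>\<^bsub>W\<^esub>} {l..<n} x'"
proof -
  interpret linear_map Z2 V W T by fact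
  interpret V: field_space V by unfold_locales
  interpret W: field_space W by unfold_locales
  have P: "P \<in> carrier_mat n n" "invertible_mat P" and Q: "Q \<in> carrier_mat m m"
    and l: "l \<le> n" "l \<le> m" and D: "smith_diagonal n m l = P * A * Q"
    using snf A unfolding smith_normal_form_def by auto
  have QQ: "Q * Qinv = 1\<^sub>m m" "Qinv * Q = 1\<^sub>m m"
    using Qinv Q unfolding inverts_mat_def by auto
  obtain P' where P': "P' \<in> carrier_mat n n" "P * P' = 1\<^sub>m n" "P' * P = 1\<^sub>m n"
    using invertible_mat_obtain[OF P(2,1)] by blast
  have "P * A = P * A * (Q * Qinv)" using P A QQ by simp
  also have "\<dots> = smith_diagonal n m l * Qinv"
    unfolding D using P A Q Qinv by (intro assoc_mult_mat[symmetric, of _ n m _ m _ m]) auto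
  finally have PA: "P * A = smith_diagonal n m l * Qinv" .
  have Tx': "T (x' j) = (if j < l then y' j else \<zero>\<^bsub>W\<^esub>)" if j: "j < n" for j
  proof -
    have "T (x' j) = lin_comb W {..<n} (\<lambda>i. T (x i)) (\<lambda>i. P $$ (j, i))"
      unfolding x'_def by (rule lin_comb_linear_map[OF T finite_lessThan x(2)])
    also have "\<dots> = lin_comb W {..<n} (\<lambda>i. lin_comb W {..<m} y (\<lambda>k. A $$ (i, k))) (\<lambda>i. P $$ (j, i))"
      using TA x(2) by (intro W.lin_comb_cong) auto
    also have "\<dots> = lin_comb W {..<m} y (\<lambda>k. \<Sum>i<n. P $$ (j, i) * A $$ (i, k))"
      by (rule W.lin_comb_lin_comb[OF _ _ y(2)]) auto
    also have "\<dots> = lin_comb W {..<m} y (\<lambda>k. if j < l then Qinv $$ (j, k) else 0)"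
    proof (rule W.lin_comb_cong[OF y(2) refl])
      fix k assume "k \<in> {..<m}"
      then have "(P * A) $$ (j, k) = (\<Sum>i<n. P $$ (j, i) * A $$ (i, k))"
        using P A j by (simp add: scalar_prod_def atLeast0LessThan del: add_bit_eq_xor mult_bit_eq_and)
      then show "(\<Sum>i<n. P $$ (j, i) * A $$ (i, k)) = (if j < l then Qinv $$ (j, k) else 0)"
        unfolding PA using smith_diagonal_mult_index[OF Qinv(1) l(2) j] \<open>k \<in> _\<close> by simp
    qed
    also have "\<dots> = (if j < l then y' j else \<zero>\<^bsub>W\<^esub>)"
      unfolding y'_def using W.lin_comb_zero[OF y(2)] by simp
    finally show ?thesis .
  qed
  have x': "basis_family V (carrier V) {..<n} x'" "x' \<in> {..<n} \<rightarrow> carrier V"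
    unfolding x'_def using V.basis_family_change_mat[OF x P(1) P'] x(2) by auto
  have y': "basis_family W (carrier W) {..<m} y'" "y' \<in> {..<m} \<rightarrow> carrier W"
    unfolding y'_def using W.basis_family_change_mat[OF y Qinv(1) Q QQ(2,1)] y(2) by auto
  show "basis_family W (T ` carrier V) {..<l} y'"
    and "basis_family V {v \<in> carrier V. T v = \<zero>\<^bsub>W\<^esub>} {l..<n} x'"
    using adapted_bases[OF T x' y' l Tx'] by auto
qed

section \<open>Existence of Smith normal forms over a field\<close>

lemma invertible_matI:
  assumes "P \<in> carrier_mat n n" "P' \<in> carrier_mat n n" "P * P' = 1\<^sub>m n" "P' * P = 1\<^sub>m n"
  shows "invertible_mat P"
  using assms unfolding invertible_mat_def inverts_mat_def by auto

lemma invertible_mat_mult: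
  assumes P: "P \<in> carrier_mat n n" "invertible_mat P" and Q: "Q \<in> carrier_mat n n" "invertible_mat Q"
  shows "invertible_mat (P * Q :: 'a::semiring_1 mat)"
proof -
  obtain P' where P': "P' \<in> carrier_mat n n" "P * P' = 1\<^sub>m n" "P' * P = 1\<^sub>m n"
    using invertible_mat_obtain[OF P(2,1)] by blast
  obtain Q' where Q': "Q' \<in> carrier_mat n n" "Q * Q' = 1\<^sub>m n" "Q' * Q = 1\<^sub>m n"
    using invertible_mat_obtain[OF Q(2,1)] by blast
  have cancel: "(A * B) * (B' * A') = 1\<^sub>m n"
    if c: "A \<in> carrier_mat n n" "B \<in> carrier_mat n n" "A' \<in> carrier_mat n n" "B' \<in> carrier_mat n n"
      and "A * A' = 1\<^sub>m n" "B * B' = 1\<^sub>m n" for A B A' B' :: "'a mat"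
  proof -
    have "(A * B) * (B' * A') = A * (B * B') * A'"
      using c by (simp add: assoc_mult_mat[of _ n n _ n _ n])
    then show ?thesis using that by simp
  qed
  show ?thesis
    using cancel[of P Q P' Q'] cancel[of Q' P' Q P] P P' Q Q'
    by (intro invertible_matI[of _ n "Q' * P'"]) auto
qed

lemma invertible_swaprows_mat:
  assumes "k < n" "l < n"
  shows "invertible_mat (swaprows_mat n k l :: 'a::comm_ring_1 mat)"
  by (rule invertible_matI[of _ n "swaprows_mat n k l"]) (use swaprows_mat_inv[OF assms] in auto)

lemma invertible_block_diag:
  assumes P: "P \<in> carrier_mat n n" "invertible_mat P"
  shows "invertible_mat (four_block_mat (1\<^sub>m k) (0\<^sub>m k n) (0\<^sub>m n k) P :: 'a::semiring_1 mat)"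
proof -
  obtain P' where P': "P' \<in> carrier_mat n n" "P * P' = 1\<^sub>m n" "P' * P = 1\<^sub>m n"
    using invertible_mat_obtain[OF P(2,1)] by blast
  have "four_block_mat (1\<^sub>m k) (0\<^sub>m k n) (0\<^sub>m n k) A * four_block_mat (1\<^sub>m k) (0\<^sub>m k n) (0\<^sub>m n k) B = 1\<^sub>m (k + n)"
    if "A \<in> carrier_mat n n" "B \<in> carrier_mat n n" "A * B = 1\<^sub>m n" for A B :: "'a mat"
    by (subst mult_four_block_mat) (use that in auto)
  then show ?thesis using P P'
    by (intro invertible_matI[of _ "k + n" "four_block_mat (1\<^sub>m k) (0\<^sub>m k n) (0\<^sub>m n k) P'"]) auto
qed

text \<open>Matrices of this shape multiply by adding their corner blocks, so negating the corner
  gives the inverse.\<close>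

lemma invertible_block_lower:
  assumes "C \<in> carrier_mat n k"
  shows "invertible_mat (four_block_mat (1\<^sub>m k) (0\<^sub>m k n) C (1\<^sub>m n) :: 'a::comm_ring_1 mat)"
proof -
  have "four_block_mat (1\<^sub>m k) (0\<^sub>m k n) A (1\<^sub>m n) * four_block_mat (1\<^sub>m k) (0\<^sub>m k n) B (1\<^sub>m n) = 1\<^sub>m (k + n)"
    if "A \<in> carrier_mat n k" "B \<in> carrier_mat n k" "A + B = 0\<^sub>m n k" for A B :: "'a mat"
    by (subst mult_four_block_mat) (use that in auto)
  from this[of C "- C"] this[of "- C" C] show ?thesis
    using assms uminus_l_inv_mat[OF assms] comm_add_mat[OF assms, of "- C"]
    by (intro invertible_matI[of _ "k + n" "four_block_mat (1\<^sub>m k) (0\<^sub>m k n) (- C) (1\<^sub>m n)"]) auto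
qed

lemma invertible_block_upper:
  assumes "B \<in> carrier_mat k n"
  shows "invertible_mat (four_block_mat (1\<^sub>m k) B (0\<^sub>m n k) (1\<^sub>m n) :: 'a::comm_ring_1 mat)"
proof -
  have "four_block_mat (1\<^sub>m k) A (0\<^sub>m n k) (1\<^sub>m n) * four_block_mat (1\<^sub>m k) B (0\<^sub>m n k) (1\<^sub>m n) = 1\<^sub>m (k + n)"
    if "A \<in> carrier_mat k n" "B \<in> carrier_mat k n" "B + A = 0\<^sub>m k n" for A B :: "'a mat"
    by (subst mult_four_block_mat) (use that in auto)
  from this[of B "- B"] this[of "- B" B] show ?thesis
    using assms uminus_l_inv_mat[OF assms] comm_add_mat[OF assms, of "- B"]
    by (intro invertible_matI[of _ "k + n" "four_block_mat (1\<^sub>m k) (- B) (0\<^sub>m n k) (1\<^sub>m n)"]) auto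
qed

lemma invertible_scalar_mat:
  assumes "c \<noteq> (0 :: 'a::field)"
  shows "invertible_mat (c \<cdot>\<^sub>m 1\<^sub>m n)"
  by (rule invertible_matI[of _ n "inverse c \<cdot>\<^sub>m 1\<^sub>m n"]) (use assms in \<open>auto intro!: eq_matI\<close>)

lemma invertible_one_mat: "invertible_mat (1\<^sub>m n :: 'a::semiring_1 mat)"
  by (rule invertible_matI[of _ n "1\<^sub>m n"]) auto

text \<open>Induction on the number of rows: a nonzero entry is moved to the corner and scaled to 1,
  its row and column are cleared, and the remaining block is treated by the induction hypothesis.
  The number of columns varies because each round also removes one column.\<close>

lemma smith_form_exists:
  fixes A :: "'a::field mat"
  assumes "A \<in> carrier_mat n m"
  shows "\<exists>P Q l. P \<in> carrier_mat n n \<and> invertible_mat P \<and> Q \<in> carrier_mat m m \<and> invertible_mat Q \<and>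
    l \<le> min n m \<and> P * A * Q = mat n m (\<lambda>(a, b). if a = b \<and> a < l then 1 else 0)"
  using assms
proof (induction n arbitrary: m A)
  case 0
  then have "1\<^sub>m 0 * A * 1\<^sub>m m = mat 0 m (\<lambda>(a, b). if a = b \<and> a < 0 then 1 else 0)"
    by (intro eq_matI) auto
  then show ?case
    using invertible_one_mat one_carrier_mat le0 by blast
next
  case (Suc n)
  show ?case
  proof (cases "A = 0\<^sub>m (Suc n) m")
    case True
    then have "1\<^sub>m (Suc n) * A * 1\<^sub>m m = mat (Suc n) m (\<lambda>(a, b). if a = b \<and> a < 0 then 1 else 0)"
      by (intro eq_matI) auto
    then show ?thesis
      using invertible_one_mat one_carrier_mat le0 by blast
  next
    case False
    have "\<exists>i<Suc n. \<exists>j<m. A $$ (i, j) \<noteq> 0"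
    proof (rule ccontr)
      assume "\<not> (\<exists>i<Suc n. \<exists>j<m. A $$ (i, j) \<noteq> 0)"
      then have "A = 0\<^sub>m (Suc n) m" using Suc.prems by (intro eq_matI) auto
      then show False using False by contradiction
    qed
    then obtain i j where ij: "i < Suc n" "j < m" "A $$ (i, j) \<noteq> 0" by blast
    then obtain m' where m: "m = Suc m'" by (cases m) auto
    define c where "c = inverse (A $$ (i, j))"
    \<comment> \<open>The whole matrix is scaled by \<open>c\<close>, not just one row; this still
      makes the corner entry 1 and keeps the transformation a scalar matrix times a swap.\<close>
    define L where "L = (c \<cdot>\<^sub>m 1\<^sub>m (Suc n)) * swaprows_mat (Suc n) 0 i"
    define R where "R = (swaprows_mat (Suc m') 0 j :: 'a mat)"
    define B where "B = L * A * R"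
    have c: "c \<noteq> 0" using ij by (simp add: c_def)
    have L: "L \<in> carrier_mat (Suc n) (Suc n)" "invertible_mat L"
      unfolding L_def using ij c
      by (auto intro!: invertible_mat_mult[of _ "Suc n"] invertible_scalar_mat invertible_swaprows_mat)
    have R: "R \<in> carrier_mat (Suc m') (Suc m')" "invertible_mat R"
      unfolding R_def using ij m by (auto intro!: invertible_swaprows_mat)
    have A: "A \<in> carrier_mat (Suc n) (Suc m')" using Suc.prems m by simp
    have B: "B \<in> carrier_mat (Suc n) (Suc m')" unfolding B_def using L R A by auto
    have "B = c \<cdot>\<^sub>m swapcols 0 j (swaprows 0 i A)"
    proof -
      have "L * A = c \<cdot>\<^sub>m swaprows 0 i A"
      proof -
        have "L * A = (c \<cdot>\<^sub>m 1\<^sub>m (Suc n)) * (swaprows_mat (Suc n) 0 i * A)"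
          unfolding L_def by (rule assoc_mult_mat[of _ "Suc n" "Suc n" _ "Suc n"]) (use A in auto)
        also have "\<dots> = c \<cdot>\<^sub>m (1\<^sub>m (Suc n) * (swaprows_mat (Suc n) 0 i * A))"
          by (rule mult_smult_assoc_mat[of _ "Suc n" "Suc n"]) (use A in auto)
        also have "\<dots> = c \<cdot>\<^sub>m swaprows 0 i A"
          using A swaprows_mat[OF A, of 0 i] ij left_mult_one_mat[of "swaprows 0 i A" "Suc n" "Suc m'"] by simp
        finally show ?thesis .
      qed
      moreover have "swapcols 0 j (swaprows 0 i A) = swaprows 0 i A * R"
        unfolding R_def by (rule swapcols_mat) (use A ij m in auto)
      ultimately show ?thesis
        unfolding B_def using A R by (simp add: mult_smult_assoc_mat[of _ "Suc n" "Suc m'"])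
    qed
    then have B00: "B $$ (0, 0) = 1" using A ij m by (auto simp: c_def)
    obtain B1 B2 B3 B4 where split: "split_block B 1 1 = (B1, B2, B3, B4)"
      by (metis prod_cases4)
    have Bs: "B1 \<in> carrier_mat 1 1" "B2 \<in> carrier_mat 1 m'" "B3 \<in> carrier_mat n 1" "B4 \<in> carrier_mat n m'"
      "B = four_block_mat B1 B2 B3 B4"
      using split_block[OF split, of n m'] B by auto
    have B1: "B1 = 1\<^sub>m 1"
      using Bs(1) split B00 by (intro eq_matI) (auto simp: split_block_def Let_def)
    define E where "E = four_block_mat (1\<^sub>m 1) (0\<^sub>m 1 n) (- B3) (1\<^sub>m n)"
    define F where "F = four_block_mat (1\<^sub>m 1) (- B2) (0\<^sub>m m' 1) (1\<^sub>m m')"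
    have E: "E \<in> carrier_mat (Suc n) (Suc n)" "invertible_mat E"
      unfolding E_def using Bs invertible_block_lower[of "- B3" n 1] by auto
    have F: "F \<in> carrier_mat (Suc m') (Suc m')" "invertible_mat F"
      unfolding F_def using Bs invertible_block_upper[of "- B2" 1 m'] by auto
    \<comment> \<open>The Schur complement of the corner entry 1: \<open>E\<close> clears the first
      column, which changes \<open>B4\<close> into \<open>D\<close>, and then \<open>F\<close>
      clears the first row without touching \<open>D\<close>.\<close>
    define D where "D = B4 - B3 * B2"
    have D: "D \<in> carrier_mat n m'" unfolding D_def using Bs by auto
    have EB: "E * B = four_block_mat (1\<^sub>m 1) B2 (0\<^sub>m n 1) D"
      unfolding E_def Bs(5) B1
      by (subst mult_four_block_mat) (use Bs in \<open>auto simp: D_def intro!: cong_four_block_mat\<close>)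
    have EBF: "E * B * F = four_block_mat (1\<^sub>m 1) (0\<^sub>m 1 m') (0\<^sub>m n 1) D"
      unfolding EB F_def
      by (subst mult_four_block_mat) (use Bs D in \<open>auto simp: intro!: cong_four_block_mat\<close>)
    obtain P Q l where PQ: "P \<in> carrier_mat n n" "invertible_mat P" "Q \<in> carrier_mat m' m'" "invertible_mat Q"
      "l \<le> min n m'" "P * D * Q = mat n m' (\<lambda>(a, b). if a = b \<and> a < l then 1 else 0)"
      using Suc.IH[OF D] by blast
    define P1 where "P1 = four_block_mat (1\<^sub>m 1) (0\<^sub>m 1 n) (0\<^sub>m n 1) P"
    define Q1 where "Q1 = four_block_mat (1\<^sub>m 1) (0\<^sub>m 1 m') (0\<^sub>m m' 1) Q"
    have P1: "P1 \<in> carrier_mat (Suc n) (Suc n)" "invertible_mat P1"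
      unfolding P1_def using PQ invertible_block_diag[of P n 1] by auto
    have Q1: "Q1 \<in> carrier_mat (Suc m') (Suc m')" "invertible_mat Q1"
      unfolding Q1_def using PQ invertible_block_diag[of Q m' 1] by auto
    have "P1 * (E * B * F) = four_block_mat (1\<^sub>m 1) (0\<^sub>m 1 m') (0\<^sub>m n 1) (P * D)"
      unfolding EBF P1_def by (subst mult_four_block_mat) (use D PQ in auto)
    then have "P1 * (E * B * F) * Q1 = four_block_mat (1\<^sub>m 1) (0\<^sub>m 1 m') (0\<^sub>m n 1) (P * D * Q)"
      unfolding Q1_def by (subst \<open>P1 * _ = _\<close>, subst mult_four_block_mat) (use D PQ in auto)
    also have "\<dots> = mat (Suc n) (Suc m') (\<lambda>(a, b). if a = b \<and> a < Suc l then 1 else 0)"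
      unfolding PQ(6) by (intro eq_matI) auto
    also have "P1 * (E * B * F) * Q1 = (P1 * E * L) * A * (R * F * Q1)"
    proof -
      note as = assoc_mult_mat[of _ "Suc n" "Suc n" _ "Suc n"] assoc_mult_mat[of _ "Suc n" "Suc n" _ "Suc m'" _ "Suc m'"]
        assoc_mult_mat[of _ "Suc n" "Suc m'" _ "Suc m'" _ "Suc m'"] assoc_mult_mat[of _ "Suc m'" "Suc m'" _ "Suc m'" _ "Suc m'"]
      show ?thesis unfolding B_def using P1 E L A R F Q1 by (simp add: as)
    qed
    finally have D: "(P1 * E * L) * A * (R * F * Q1) = mat (Suc n) (Suc m') (\<lambda>(a, b). if a = b \<and> a < Suc l then 1 else 0)"
      by simp
    have PEL: "P1 * E * L \<in> carrier_mat (Suc n) (Suc n)" "invertible_mat (P1 * E * L)"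
      using P1 E L by (auto intro!: invertible_mat_mult[of _ "Suc n"])
    have RFQ: "R * F * Q1 \<in> carrier_mat (Suc m') (Suc m')" "invertible_mat (R * F * Q1)"
      using R F Q1 by (auto intro!: invertible_mat_mult[of _ "Suc m'"])
    have "Suc l \<le> min (Suc n) (Suc m')" using PQ(5) by simp
    then show ?thesis unfolding m using PEL RFQ D by blast
  qed
qed

lemma smith_normal_form_exists: "\<exists>P Q l. smith_normal_form A P Q l"
proof -
  have "A \<in> carrier_mat (dim_row A) (dim_col A)" by auto
  from smith_form_exists[OF this] obtain P Q l
    where "P \<in> carrier_mat (dim_row A) (dim_row A)" "invertible_mat P"
      "Q \<in> carrier_mat (dim_col A) (dim_col A)" "invertible_mat Q" "l \<le> min (dim_row A) (dim_col A)"
      "P * A * Q = mat (dim_row A) (dim_col A) (\<lambda>(a, b). if a = b \<and> a < l then 1 else 0)"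
    by blast
  then have "smith_normal_form A P Q l"
    unfolding smith_normal_form_def smith_diagonal_def by (simp only: simp_thms)
  then show ?thesis by blast
qed

section \<open>Row reduction\<close>

context
  notes add_bit_eq_xor [simp del] and mult_bit_eq_and [simp del]
begin

lemma eliminate_index:
  assumes "a < dim_row A" "b < dim_col A"
  shows "eliminate A p c T $$ (a, b) = A $$ (a, b) + (if a \<in> T then A $$ (a, c) else 0) * A $$ (p, b)"
  using assms by (simp add: eliminate_def)

lemma dim_eliminate [simp]:
  "dim_row (eliminate A p c T) = dim_row A" "dim_col (eliminate A p c T) = dim_col A"
  by (simp_all add: eliminate_def)

text \<open>One entry of a linear combination of rows. Keeping the column as an argument allows
  relations to be tested on the pivot columns alone.\<close>

definition row_comb :: "bit mat \<Rightarrow> nat set \<Rightarrow> (nat \<Rightarrow> bit) \<Rightarrow> nat \<Rightarrow> bit" where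
  "row_comb C S v b = (\<Sum>s\<in>S. v s * C $$ (s, b))"

lemma row_comb_insert:
  "finite S \<Longrightarrow> p \<notin> S \<Longrightarrow> row_comb C (insert p S) v b = v p * C $$ (p, b) + row_comb C S v b"
  by (simp add: row_comb_def)

lemma row_comb_cong: "(\<And>s. s \<in> S \<Longrightarrow> v s = w s) \<Longrightarrow> row_comb C S v b = row_comb C S w b"
  by (simp add: row_comb_def)

lemma row_comb_add: "row_comb C S (\<lambda>s. v s + w s) b = row_comb C S v b + row_comb C S w b"
  by (simp add: row_comb_def distrib_right sum.distrib)

lemma row_comb_mult: "row_comb C S (\<lambda>s. k * v s) b = k * row_comb C S v b"
  by (simp add: row_comb_def sum_distrib_left mult.assoc)

lemma bit_add_self [simp]: "x + x = (0 :: bit)"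
  by (cases x) (simp_all add: add_bit_eq_xor)

lemma elimination_dim:
  assumes "elimination C A S"
  shows "dim_row A = dim_row C" "dim_col A = dim_col C" "S \<subseteq> {..<dim_row C}"
proof -
  have "dim_row A = dim_row C \<and> dim_col A = dim_col C \<and> S \<subseteq> {..<dim_row C}"
    using assms by induction auto
  then show "dim_row A = dim_row C" "dim_col A = dim_col C" "S \<subseteq> {..<dim_row C}" by auto
qed

text \<open>
  Restricted to the pivot columns \<open>X\<close>, the rows of \<open>C\<close> that have served as pivot rows are
  independent, and the remaining rows of the current matrix \<open>A\<close> vanish.
\<close>

definition pivot_columns :: "bit mat \<Rightarrow> bit mat \<Rightarrow> nat set \<Rightarrow> nat set \<Rightarrow> bool" where
  "pivot_columns C A S X \<longleftrightarrow> X \<subseteq> {..<dim_col C} \<and>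
    (\<forall>v. (\<forall>c\<in>X. row_comb C S v c = 0) \<longrightarrow> (\<forall>s\<in>S. v s = 0)) \<and>
    (\<forall>a<dim_row C. a \<notin> S \<longrightarrow> (\<forall>c\<in>X. A $$ (a, c) = 0)) \<and>
    (\<forall>a\<in>S. \<exists>c\<in>X. A $$ (a, c) = 1) \<and>
    (\<forall>a<dim_row C. \<exists>v. \<forall>b<dim_col C. A $$ (a, b) = C $$ (a, b) + row_comb C S v b)"

lemma pivot_columnsD:
  assumes "pivot_columns C A S X"
  shows "X \<subseteq> {..<dim_col C}"
    and "(\<And>c. c \<in> X \<Longrightarrow> row_comb C S v c = 0) \<Longrightarrow> s \<in> S \<Longrightarrow> v s = 0"
    and "a < dim_row C \<Longrightarrow> a \<notin> S \<Longrightarrow> c \<in> X \<Longrightarrow> A $$ (a, c) = 0"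
    and "a \<in> S \<Longrightarrow> \<exists>c\<in>X. A $$ (a, c) = 1"
    and "a < dim_row C \<Longrightarrow> \<exists>v. \<forall>b<dim_col C. A $$ (a, b) = C $$ (a, b) + row_comb C S v b"
  using assms unfolding pivot_columns_def by blast+

text \<open>A new pivot row \<open>p\<close> has not been used before, so it vanishes on the earlier
  pivot columns \<open>X\<close>. Adding it to other rows therefore leaves those columns unchanged,
  and the invariant only has to be extended by the column \<open>c\<close>.\<close>

lemma elimination_invariant:
  assumes "elimination C A S"
  shows "\<exists>X. pivot_columns C A S X"
  using assms
proof induction
  case start
  then show ?case by (intro exI[of _ "{}"]) (auto simp: row_comb_def pivot_columns_def)
next
  case (pivot A S p c T)
  note dims = elimination_dim[OF pivot.hyps(1)]
  have fin: "finite S" using dims(3) finite_subset by blast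
  obtain X where PC: "pivot_columns C A S X" using pivot.IH by blast
  note X = pivot_columnsD(1)[OF PC] and indep = pivot_columnsD(2)[OF PC] and zero = pivot_columnsD(3)[OF PC]
    and one = pivot_columnsD(4)[OF PC] and comb = pivot_columnsD(5)[OF PC]
  have p: "p < dim_row C" "p \<notin> S" "c < dim_col C" "A $$ (p, c) = 1" using pivot.hyps dims by auto
  have ix: "eliminate A p c T $$ (a, b) = A $$ (a, b) + (if a \<in> T then A $$ (a, c) else 0) * A $$ (p, b)"
    if "a < dim_row C" "b < dim_col C" for a b
    by (rule eliminate_index) (use that dims in auto)
  obtain w where w: "\<And>b. b < dim_col C \<Longrightarrow> A $$ (p, b) = C $$ (p, b) + row_comb C S w b"
    using comb[OF p(1)] by blast
  have old: "eliminate A p c T $$ (a, b) = A $$ (a, b)" if "a < dim_row C" "b \<in> X" for a b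
    using ix[OF that(1), of b] that X zero[OF p(1,2)] by auto
  \<comment> \<open>Row \<open>p\<close> of \<open>C\<close> is replaced by the current row
    \<open>p\<close> plus the combination \<open>w\<close> of old pivot rows. On \<open>X\<close>
    the current row vanishes, so the old independence makes all combined coefficients
    \<open>v p * w s + v s\<close> zero. At column \<open>c\<close> only \<open>v p\<close> times
    the pivot entry 1 is left, hence \<open>v p = 0\<close> and then \<open>v s = 0\<close>.\<close>
  have new_indep: "\<forall>s\<in>insert p S. v s = 0" if v: "\<forall>b\<in>insert c X. row_comb C (insert p S) v b = 0" for v
  proof -
    have Cp: "C $$ (p, b) = A $$ (p, b) + row_comb C S w b" if "b < dim_col C" for b
      using w[OF that] by (simp add: add.assoc)
    have eq: "v p * A $$ (p, b) + row_comb C S (\<lambda>s. v p * w s + v s) b = 0" if "b \<in> insert c X" for b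
    proof -
      have b: "b < dim_col C" using that X p by auto
      have "row_comb C (insert p S) v b = 0" using v that by blast
      then show ?thesis
        by (simp add: row_comb_insert[OF fin p(2)] Cp[OF b] row_comb_add row_comb_mult distrib_left add.assoc)
    qed
    have "row_comb C S (\<lambda>s. v p * w s + v s) b = 0" if "b \<in> X" for b
      using eq[of b] zero[OF p(1,2) that] that by simp
    then have *: "\<forall>s\<in>S. v p * w s + v s = 0" by (intro ballI indep[of "\<lambda>s. v p * w s + v s"])
    then have "row_comb C S (\<lambda>s. v p * w s + v s) c = 0" by (simp add: row_comb_def)
    then have "v p = 0" using eq[of c] p(4) by simp
    then show ?thesis using * by simp
  qed
  have new_zero: "eliminate A p c T $$ (a, b) = 0" if "a < dim_row C" "a \<notin> insert p S" "b \<in> insert c X" for a b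
  proof (cases "b \<in> X")
    case True
    then show ?thesis using old zero that by simp
  next
    case False
    then have "b = c" "a \<in> T" using that pivot.hyps(6) dims by auto
    then show ?thesis using ix[OF that(1) p(3)] p(4) by simp
  qed
  have new_one: "\<exists>b\<in>insert c X. eliminate A p c T $$ (a, b) = 1" if "a \<in> insert p S" for a
  proof (cases "a = p")
    case True
    \<comment> \<open>The pivot row is excluded from \<open>T\<close>, so its entry 1 in column
      \<open>c\<close> survives.\<close>
    then show ?thesis using ix[OF p(1,3)] pivot.hyps(7) p(4) by auto
  next
    case False
    then have "a \<in> S" using that by simp
    from one[OF this] obtain b where "b \<in> X" "A $$ (a, b) = 1" by blast
    then show ?thesis using old[of a b] False that dims by auto
  qed
  have new_comb: "\<exists>v. \<forall>b<dim_col C. eliminate A p c T $$ (a, b) = C $$ (a, b) + row_comb C (insert p S) v b"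
    if a: "a < dim_row C" for a
  proof -
    obtain u where u: "\<And>b. b < dim_col C \<Longrightarrow> A $$ (a, b) = C $$ (a, b) + row_comb C S u b"
      using comb[OF a] by blast
    define k where "k = (if a \<in> T then A $$ (a, c) else 0)"
    \<comment> \<open>The added multiple \<open>k\<close> of the current row \<open>p\<close>
      contributes row \<open>p\<close> of \<open>C\<close> with coefficient \<open>k\<close> and,
      because that current row already contains the combination \<open>w\<close>, also
      \<open>k * w s\<close> for each old pivot row.\<close>
    define v where "v = (\<lambda>s. if s = p then k else u s + k * w s)"
    have v: "row_comb C S v b = row_comb C S u b + k * row_comb C S w b" for b
      unfolding row_comb_mult[symmetric] row_comb_add[symmetric]
      by (rule row_comb_cong) (use p(2) in \<open>auto simp: v_def\<close>)
    have "v p = k" by (simp add: v_def)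
    then have "eliminate A p c T $$ (a, b) = C $$ (a, b) + row_comb C (insert p S) v b" if "b < dim_col C" for b
      unfolding row_comb_insert[OF fin p(2)] v
      using ix[OF a that] u[OF that] w[OF that] by (simp add: k_def[symmetric] algebra_simps)
    then show ?thesis by blast
  qed
  have "insert c X \<subseteq> {..<dim_col C}" using X p by auto
  then have "pivot_columns C (eliminate A p c T) (insert p S) (insert c X)"
    unfolding pivot_columns_def
    by (intro conjI allI impI) (assumption | rule new_indep, assumption | rule ballI, rule new_zero, assumption+ | rule ballI, rule new_one, assumption | rule new_comb, assumption)+
  then show ?case ..
qed

text \<open>A pivot row keeps an entry 1 in some pivot column and so ends nonzero; every other row
  ends zero by the stopping condition. For such a row, the zero result is the original row plus a
  combination of pivot rows, so in characteristic two the original row equals that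
  combination.\<close>

lemma row_reduction_pivot_rows:
  assumes "row_reduction C R"
  obtains S where "S \<subseteq> {..<dim_row C}" "{a. a < dim_row R \<and> row R a \<noteq> 0\<^sub>v (dim_col R)} = S"
    and "\<And>v. (\<And>b. b < dim_col C \<Longrightarrow> row_comb C S v b = 0) \<Longrightarrow> \<forall>s\<in>S. v s = 0"
    and "\<And>a. a < dim_row C \<Longrightarrow> \<exists>v. \<forall>b<dim_col C. C $$ (a, b) = row_comb C S v b"
proof -
  obtain S where S: "elimination C R S" and zero: "\<And>a. a < dim_row R \<Longrightarrow> a \<notin> S \<Longrightarrow> row R a = 0\<^sub>v (dim_col R)"
    using assms unfolding row_reduction_def by blast
  note dims = elimination_dim[OF S]
  obtain X where PC: "pivot_columns C R S X" using elimination_invariant[OF S] by blast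
  note X = pivot_columnsD(1)[OF PC] and indep = pivot_columnsD(2)[OF PC]
    and one = pivot_columnsD(4)[OF PC] and comb = pivot_columnsD(5)[OF PC]
  have fin: "finite S" using dims(3) finite_subset by blast
  have R0: "R $$ (a, b) = 0" if "a < dim_row C" "b < dim_col C" "row R a = 0\<^sub>v (dim_col R)" for a b
  proof -
    have "R $$ (a, b) = row R a $ b" using that(1,2) dims by simp
    also have "\<dots> = 0" unfolding that(3) using that(2) dims by simp
    finally show ?thesis .
  qed
  show ?thesis
  proof
    show "S \<subseteq> {..<dim_row C}" by fact
    show "{a. a < dim_row R \<and> row R a \<noteq> 0\<^sub>v (dim_col R)} = S"
    proof (intro equalityI subsetI)
      fix a assume a: "a \<in> S"
      then obtain c where "c \<in> X" "R $$ (a, c) = 1" using one by blast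
      then have "row R a \<noteq> 0\<^sub>v (dim_col R)" using R0[of a c] a X dims by auto
      then show "a \<in> {a. a < dim_row R \<and> row R a \<noteq> 0\<^sub>v (dim_col R)}" using a dims by auto
    qed (use zero in auto)
    show "\<forall>s\<in>S. v s = 0" if "\<And>b. b < dim_col C \<Longrightarrow> row_comb C S v b = 0" for v
      by (intro ballI indep[of v]) (use that X in auto)
    show "\<exists>v. \<forall>b<dim_col C. C $$ (a, b) = row_comb C S v b" if a: "a < dim_row C" for a
    proof (cases "a \<in> S")
      case True
      have "C $$ (a, b) = row_comb C S (\<lambda>s. if s = a then 1 else 0) b" for b
      proof -
        have "row_comb C S (\<lambda>s. if s = a then 1 else 0) b = (\<Sum>s\<in>S. if s = a then C $$ (s, b) else 0)"
          unfolding row_comb_def by (rule sum.cong) auto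
        then show ?thesis using True fin by simp
      qed
      then show ?thesis by blast
    next
      case False
      obtain v where v: "\<forall>b<dim_col C. R $$ (a, b) = C $$ (a, b) + row_comb C S v b"
        using comb[OF a] by blast
      have "C $$ (a, b) = row_comb C S v b" if "b < dim_col C" for b
      proof -
        have "C $$ (a, b) + row_comb C S v b = 0"
          using v that R0[OF a that] zero[of a] a False dims by simp
        then have "C $$ (a, b) + (row_comb C S v b + row_comb C S v b) = row_comb C S v b"
          by (simp only: add.assoc[symmetric] add_0)
        then show ?thesis by simp
      qed
      then show ?thesis by blast
    qed
  qed
qed

lemma elimination_completes:
  assumes "elimination C A S"
  shows "\<exists>R. row_reduction C R"
  using assms
proof (induction "dim_row C - card S" arbitrary: A S rule: less_induct)
  case less
  note dims = elimination_dim[OF less.prems]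
  show ?case
  proof (cases "\<forall>a<dim_row A. a \<notin> S \<longrightarrow> row A a = 0\<^sub>v (dim_col A)")
    case True
    then show ?thesis using less.prems unfolding row_reduction_def by blast
  next
    case False
    then obtain p where p: "p < dim_row A" "p \<notin> S" "row A p \<noteq> 0\<^sub>v (dim_col A)" by blast
    then obtain c where c: "c < dim_col A" "A $$ (p, c) \<noteq> 0"
      by (metis eq_vecI index_row(1) index_row(2) index_zero_vec(1) index_zero_vec(2))
    \<comment> \<open>The smallest admissible choice of \<open>T\<close>: rows that have served as
      pivots are left alone, giving an echelon form that is not reduced.\<close>
    have el: "elimination C (eliminate A p c ({..<dim_row A} - insert p S)) (insert p S)"
      by (rule elimination.pivot[OF less.prems p(1,2) c(1)]) (use c in auto)
    have "card (insert p S) \<le> dim_row C"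
      using card_mono[OF _ elimination_dim(3)[OF el]] by simp
    moreover have "card (insert p S) = Suc (card S)"
      using p dims(3) finite_subset by (metis card_insert_disjoint finite_lessThan)
    ultimately show ?thesis by (intro less.hyps[OF _ el]) simp
  qed
qed

lemma row_reduction_exists: "\<exists>R. row_reduction C R"
  by (rule elimination_completes[OF elimination.start])

end

section \<open>Extending independent sets\<close>

context vectorspace
begin

text \<open>The added vectors must come from the given \<open>D\<close>, since the selection is made
  inside \<open>Dbar\<close>. A maximal subset of \<open>D\<close> that is disjoint from
  \<open>C\<close> and independent together with it works: an element of \<open>D\<close> outside
  the span could still be added.\<close>

lemma indep_extend_from_generators:
  assumes C: "C \<subseteq> carrier V" "lin_indpt C" and D: "finite D" "D \<subseteq> carrier V" "gen_set D"
  obtains X where "X \<subseteq> D" "C \<inter> X = {}" "basis (C \<union> X)"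
proof -
  define F where "F = {X. X \<subseteq> D \<and> C \<inter> X = {} \<and> lin_indpt (C \<union> X)}"
  have "finite F" by (rule finite_subset[of _ "Pow D"]) (use D in \<open>auto simp: F_def\<close>)
  moreover have "F \<noteq> {}" using C by (auto simp: F_def intro: exI[of _ "{}"])
  ultimately obtain X where "X \<in> F" and max: "\<forall>Y\<in>F. X \<subseteq> Y \<longrightarrow> X = Y"
    using finite_has_maximal[of F] by auto
  then have X: "X \<subseteq> D" "C \<inter> X = {}" "lin_indpt (C \<union> X)" by (simp_all add: F_def)
  have CX: "C \<union> X \<subseteq> carrier V" using X C D by auto
  have "d \<in> span (C \<union> X)" if d: "d \<in> D" for d
  proof (cases "d \<in> C \<union> X")
    case True
    then show ?thesis using in_own_span[OF CX] by blast
  next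
    case False
    show ?thesis
    proof (rule ccontr)
      assume "d \<notin> span (C \<union> X)"
      then have "lin_indpt (C \<union> X \<union> {d})"
        using lin_dep_iff_in_span[OF CX _ _ False] X D d by blast
      then have "insert d X \<in> F" using X False d by (simp add: F_def)
      then show False using max False by blast
    qed
  qed
  then have "span D \<subseteq> span (C \<union> X)"
    using span_is_subset[OF _ span_is_submodule[OF CX]] by blast
  then have "gen_set (C \<union> X)" using D(3) span_is_subset2[OF CX] by auto
  then show ?thesis using X CX that[of X] unfolding basis_def by blast
qed

text \<open>The elements of \<open>B\<close> are added one at a time. What has been collected so far
  lies in \<open>C\<close> together with \<open>B - {b}\<close>, so the assumption for
  \<open>b\<close> applies by monotonicity of spans.\<close>

lemma indep_union:
  assumes C: "C \<subseteq> carrier V" "lin_indpt C" and B: "finite B" "B \<subseteq> carrier V"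
    and ni: "\<And>b. b \<in> B \<Longrightarrow> b \<notin> span (C \<union> (B - {b}))"
  shows "lin_indpt (C \<union> B)"
proof -
  have "lin_indpt (C \<union> B')" if "finite B'" "B' \<subseteq> B" for B'
    using that
  proof (induction B')
    case (insert b B')
    have CB: "C \<union> B' \<subseteq> carrier V" using C B insert.prems by auto
    show ?case
    proof (cases "b \<in> C")
      case True
      then show ?thesis using insert by (simp add: insert_absorb)
    next
      case False
      have "span (C \<union> B') \<subseteq> span (C \<union> (B - {b}))"
        by (rule span_is_monotone) (use insert in auto)
      then have "b \<notin> span (C \<union> B')" using ni insert.prems by auto
      then have "lin_indpt (C \<union> B' \<union> {b})"
        using lin_dep_iff_in_span[OF CB, of b] insert False B by auto
      then show ?thesis by simp
    qed
  qed (use C in simp)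
  then show ?thesis using B by blast
qed

lemma indep_notin_span:
  assumes "lin_indpt A" "A \<subseteq> carrier V" "b \<in> A"
  shows "b \<notin> span (A - {b})"
proof -
  have "lin_indpt (A - {b})" by (rule subset_li_is_li[OF assms(1)]) auto
  moreover have "A - {b} \<union> {b} = A" using assms by auto
  ultimately show ?thesis
    using lin_dep_iff_in_span[of "A - {b}" b] assms by auto
qed

end

section \<open>Vector spaces over the field with two elements, and the selection step\<close>

locale z2_space = field_space V for V :: "(bit, 'v) module"
begin

lemma add_self: "v \<in> carrier V \<Longrightarrow> v \<oplus>\<^bsub>V\<^esub> v = \<zero>\<^bsub>V\<^esub>"
  using smult_l_distr[of 1 1 v] lmult_0[of v] smult_one[of v] by simp

lemma minus_eq_self: "v \<in> carrier V \<Longrightarrow> \<ominus>\<^bsub>V\<^esub> v = v"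
  using add_self[of v] minus_equality[of v v] by simp

lemma add_eq_zero_imp_eq:
  assumes "v \<in> carrier V" "w \<in> carrier V" "v \<oplus>\<^bsub>V\<^esub> w = \<zero>\<^bsub>V\<^esub>"
  shows "v = w"
  using minus_equality[OF assms(3,2,1)] minus_eq_self[OF assms(2)] by simp

lemma lin_comb_in_subspace:
  assumes "submodule class_ring W V" "finite I" "x \<in> I \<rightarrow> W"
  shows "lin_comb V I x a \<in> W"
  using assms(2,3)
proof (induction I)
  case empty
  then show ?case using submodule.zero_closed[OF assms(1)] by simp
next
  case (insert i I)
  have "x \<in> insert i I \<rightarrow> carrier V" using insert.prems submodule.subset[OF assms(1)] by auto
  then show ?case
    using insert submodule.m_closed[OF assms(1)] submodule.smult_closed[OF assms(1)]
    by (simp add: lin_comb_insert)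
qed

text \<open>Finite sums in HOL-Algebra are defined relative to the carrier, so shrinking the carrier
  to \<open>W\<close> calls for an induction over the summands.\<close>

lemma lin_comb_vs:
  assumes "subspace class_ring W V" "finite I" "x \<in> I \<rightarrow> W"
  shows "lin_comb (vs W) I x a = lin_comb V I x a"
proof -
  interpret W: vectorspace class_ring "vs W" by (rule subspace_is_vs[OF assms(1)])
  interpret W: field_space "vs W" by unfold_locales
  have WV: "W \<subseteq> carrier V" by (rule submodule.subset[OF is_module[OF assms(1)]])
  show ?thesis using assms(2,3)
  proof (induction I)
    case empty
    then show ?case using W.lin_comb_empty[of x a] by simp
  next
    case (insert i I)
    have "x \<in> insert i I \<rightarrow> carrier V" using insert.prems WV by auto
    then show ?case
      using insert W.lin_comb_insert[of I i x a] by (simp add: lin_comb_insert)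
  qed
qed

text \<open>The dimension of \<open>Z\<close> is \<open>card D\<close>. Extending \<open>C\<close>
  inside \<open>D\<close> to a basis shows that \<open>n\<close> elements can be selected;
  conversely, any admissible selection is independent together with \<open>C\<close> and has exactly
  the number of elements that makes the union a basis.\<close>

lemma selection_step_completes_basis:
  assumes Z: "subspace class_ring Z V" and W: "subspace class_ring W V" and WZ: "W \<subseteq> Z"
    and C: "finite C" "subspace_basis V W C" and D: "finite D" "subspace_basis V Z D"
    and n: "n = card D - card C"
  shows "\<exists>B. selection_step V C D n B"
    and "selection_step V C D n B \<Longrightarrow> finite B \<and> C \<inter> B = {} \<and> subspace_basis V Z (C \<union> B)"
proof -
  interpret Z: vectorspace class_ring "vs Z" by (rule subspace_is_vs[OF Z])
  have smZ: "submodule class_ring Z V" and smW: "submodule class_ring W V"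
    using Z W by (simp_all only: is_module)
  have CW: "C \<subseteq> W" and "Z.lin_indpt C"
    using C(2) span_li_not_depend[OF _ smW, of C] span_li_not_depend[OF _ smZ, of C] WZ
    unfolding subspace_basis_def vectorspace.basis_def[OF subspace_is_vs[OF W]] by auto
  then have CZ: "C \<subseteq> Z" using WZ by auto
  have DZ: "D \<subseteq> Z" "Z.basis D" "Z.gen_set D"
    using D(2) unfolding subspace_basis_def Z.basis_def by auto
  have dim: "Z.dim = card D" by (rule Z.dim_basis[OF D(1) DZ(2)])
  have fd: "Z.fin_dim" unfolding Z.fin_dim_def using D(1) DZ by auto
  \<comment> \<open>\<open>n\<close> is a truncated difference of natural numbers; this inequality
    makes \<open>card C + n\<close> equal to \<open>card D\<close>.\<close>
  have le: "card C \<le> card D" using Z.li_le_dim(2)[OF fd _ \<open>Z.lin_indpt C\<close>] CZ dim by simp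
  have span: "Z.span X = span X" if "X \<subseteq> Z" for X
    using span_li_not_depend(1)[OF that smZ] by simp
  obtain X where X: "X \<subseteq> D" "C \<inter> X = {}" "Z.basis (C \<union> X)"
    using Z.indep_extend_from_generators[of C D] CZ \<open>Z.lin_indpt C\<close> D(1) DZ by auto
  have finX: "finite X" using X(1) D(1) finite_subset by auto
  have "card (C \<union> X) = card D" using Z.dim_basis[OF _ X(3)] C(1) finX dim by simp
  then have "card X = n" using card_Un_disjoint[OF C(1) finX X(2)] n by simp
  moreover have "b \<notin> span (C \<union> (X - {b}))" if "b \<in> X" for b
  proof -
    have "b \<notin> Z.span (C \<union> X - {b})"
      using Z.indep_notin_span[of "C \<union> X" b] X(3) that unfolding Z.basis_def by auto
    moreover have "C \<union> X - {b} = C \<union> (X - {b})" using X(2) that by auto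
    moreover have "C \<union> (X - {b}) \<subseteq> Z" using CZ X(1) DZ by auto
    ultimately show ?thesis using span by metis
  qed
  ultimately show "\<exists>B. selection_step V C D n B"
    unfolding selection_step_def using X(1) by blast
  assume "selection_step V C D n B"
  then have B: "B \<subseteq> D" "card B = n" "\<And>b. b \<in> B \<Longrightarrow> b \<notin> span (C \<union> (B - {b}))"
    unfolding selection_step_def by auto
  have finB: "finite B" using B(1) D(1) finite_subset by auto
  have CB: "C \<union> B \<subseteq> Z" using CZ B(1) DZ by auto
  \<comment> \<open>An element of \<open>B\<close> that also belongs to \<open>C\<close> would lie
    in the span of \<open>C\<close>, which the selection rules out.\<close>
  have disj: "C \<inter> B = {}"
  proof (rule ccontr)
    assume "C \<inter> B \<noteq> {}"
    then obtain b where b: "b \<in> C" "b \<in> B" by auto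
    have "C \<union> (B - {b}) \<subseteq> carrier V" using CB submodule.subset[OF smZ] by auto
    then show False using in_own_span[of "C \<union> (B - {b})"] b B(3) by auto
  qed
  have "Z.lin_indpt (C \<union> B)"
  proof (rule Z.indep_union)
    show "b \<notin> Z.span (C \<union> (B - {b}))" if "b \<in> B" for b
      using span[of "C \<union> (B - {b})"] B(3)[OF that] CB by auto
  qed (use CZ finB CB \<open>Z.lin_indpt C\<close> in auto)
  moreover have "card (C \<union> B) = card D"
    using card_Un_disjoint[OF C(1) finB disj] B(2) n le by simp
  ultimately have "Z.basis (C \<union> B)"
    using CB finB C(1) dim by (intro Z.dim_li_is_basis[OF fd]) auto
  then show "finite B \<and> C \<inter> B = {} \<and> subspace_basis V Z (C \<union> B)"
    using finB disj by (simp add: subspace_basis_def)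
qed

end

section \<open>Complements and quotients\<close>

text \<open>\<open>X\<close> is independent modulo \<open>W\<close> and spans \<open>Z\<close>
  modulo \<open>W\<close>. The condition is phrased with vectors and coefficients so that no cosets
  are involved.\<close>

definition complement_basis :: "(bit, 'v) module \<Rightarrow> 'v set \<Rightarrow> 'v set \<Rightarrow> 'v set \<Rightarrow> bool" where
  "complement_basis V Z W X \<longleftrightarrow> X \<subseteq> Z \<and>
    (\<forall>a. lin_comb V X (\<lambda>x. x) a \<in> W \<longrightarrow> (\<forall>x\<in>X. a x = 0)) \<and>
    (\<forall>z\<in>Z. \<exists>a. \<exists>w\<in>W. z = lin_comb V X (\<lambda>x. x) a \<oplus>\<^bsub>V\<^esub> w)"

context z2_space
begin

lemma complement_basis_of_basis:
  assumes W: "subspace class_ring W V" and Z: "subspace class_ring Z V"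
    and fin: "finite C" "finite B" and disj: "C \<inter> B = {}"
    and C: "subspace_basis V W C" and CB: "subspace_basis V Z (C \<union> B)"
  shows "complement_basis V Z W B"
proof -
  have C': "C \<subseteq> W" "basis_family V W C (\<lambda>v. v)"
    and CB': "C \<union> B \<subseteq> Z" "basis_family V Z (C \<union> B) (\<lambda>v. v)"
    using basis_vs_iff[OF W fin(1)] basis_vs_iff[OF Z, of "C \<union> B"] C CB fin
    by (simp_all add: subspace_basis_def)
  have ZV: "Z \<subseteq> carrier V" by (rule submodule.subset[OF is_module[OF Z]])
  have split: "lin_comb V (C \<union> B) (\<lambda>v. v) a = lin_comb V C (\<lambda>v. v) a \<oplus>\<^bsub>V\<^esub> lin_comb V B (\<lambda>v. v) a" for a
    by (rule lin_comb_union) (use fin disj CB' ZV in auto)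
  have W_range: "W = range (lin_comb V C (\<lambda>v. v))" and Z_range: "Z = range (lin_comb V (C \<union> B) (\<lambda>v. v))"
    using C'(2) CB'(2) by (simp_all add: basis_family_def)
  have cl: "lin_comb V C (\<lambda>v. v) a \<in> carrier V" "lin_comb V B (\<lambda>v. v) a \<in> carrier V" for a
    using CB' ZV by auto
  have "a x = 0" if a: "lin_comb V B (\<lambda>v. v) a \<in> W" and x: "x \<in> B" for a x
  proof -
    obtain c where c: "lin_comb V B (\<lambda>v. v) a = lin_comb V C (\<lambda>v. v) c"
      using a unfolding W_range by auto
    \<comment> \<open>The coefficients of the two equal combinations are glued along the disjoint
      union; the result is a vector added to itself, which is zero in characteristic two.\<close>
    let ?e = "\<lambda>v. if v \<in> C then c v else a v"
    have "lin_comb V C (\<lambda>v. v) ?e = lin_comb V C (\<lambda>v. v) c"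
      by (rule lin_comb_cong) (use CB' ZV in auto)
    moreover have "lin_comb V B (\<lambda>v. v) ?e = lin_comb V B (\<lambda>v. v) a"
      by (rule lin_comb_cong) (use CB' ZV disj in auto)
    ultimately have "lin_comb V (C \<union> B) (\<lambda>v. v) ?e = \<zero>\<^bsub>V\<^esub>"
      unfolding split c using add_self cl by metis
    then have "?e x = 0" by (rule basis_family_indep[OF CB'(2)]) (use x in auto)
    moreover have "x \<notin> C" using x disj by blast
    ultimately show ?thesis by simp
  qed
  moreover have "\<exists>a. \<exists>w\<in>W. z = lin_comb V B (\<lambda>v. v) a \<oplus>\<^bsub>V\<^esub> w" if "z \<in> Z" for z
  proof -
    obtain a where "z = lin_comb V (C \<union> B) (\<lambda>v. v) a"
      using \<open>z \<in> Z\<close> unfolding Z_range by blast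
    then have "z = lin_comb V B (\<lambda>v. v) a \<oplus>\<^bsub>V\<^esub> lin_comb V C (\<lambda>v. v) a"
      using a_comm cl by (simp add: split)
    then show ?thesis unfolding W_range by blast
  qed
  ultimately show ?thesis using CB'(1) unfolding complement_basis_def by blast
qed

text \<open>Here \<open>C\<close> may be any finite basis of \<open>W\<close>. The lemma is applied
  to the basis \<open>E\<close> from the row reduction, which was found without reference to
  \<open>B\<close>.\<close>

lemma basis_of_complement_basis:
  assumes W: "subspace class_ring W V" and Z: "subspace class_ring Z V" and WZ: "W \<subseteq> Z"
    and fin: "finite C" "finite B"
    and C: "subspace_basis V W C" and B: "complement_basis V Z W B"
  shows "B \<inter> C = {}" and "subspace_basis V Z (B \<union> C)"
proof -
  have C': "C \<subseteq> W" "basis_family V W C (\<lambda>v. v)"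
    using basis_vs_iff[OF W fin(1)] C by (simp_all add: subspace_basis_def)
  have BZ: "B \<subseteq> Z" and indep: "\<And>a x. lin_comb V B (\<lambda>v. v) a \<in> W \<Longrightarrow> x \<in> B \<Longrightarrow> a x = 0"
    and span: "\<And>z. z \<in> Z \<Longrightarrow> \<exists>a. \<exists>w\<in>W. z = lin_comb V B (\<lambda>v. v) a \<oplus>\<^bsub>V\<^esub> w"
    using B unfolding complement_basis_def by blast+
  have smZ: "submodule class_ring Z V" and smW: "submodule class_ring W V"
    by (rule is_module, fact)+
  have ZV: "Z \<subseteq> carrier V" by (rule submodule.subset[OF smZ])
  have W_range: "W = range (lin_comb V C (\<lambda>v. v))"
    using C'(2) by (simp add: basis_family_def)
  show disj: "B \<inter> C = {}"
  proof (rule ccontr)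
    assume "B \<inter> C \<noteq> {}"
    then obtain b where b: "b \<in> B" "b \<in> C" by auto
    \<comment> \<open>The unit coefficients at a common element would give a nontrivial combination
      of \<open>B\<close> lying in \<open>W\<close>.\<close>
    have "lin_comb V B (\<lambda>v. v) (\<lambda>i. if i = b then 1 else 0) = b"
      using lin_comb_unit[OF fin(2) b(1), of "\<lambda>v. v"] BZ ZV by auto
    then have "(if b = b then 1 else 0 :: bit) = 0"
      using b C' by (intro indep[of "\<lambda>i. if i = b then 1 else 0"]) auto
    then show False by simp
  qed
  have split: "lin_comb V (B \<union> C) (\<lambda>v. v) a = lin_comb V B (\<lambda>v. v) a \<oplus>\<^bsub>V\<^esub> lin_comb V C (\<lambda>v. v) a" for a
    by (rule lin_comb_union) (use fin disj BZ C' WZ ZV in auto)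
  have cl: "lin_comb V C (\<lambda>v. v) a \<in> W" "lin_comb V B (\<lambda>v. v) a \<in> Z" for a
    using lin_comb_in_subspace[OF smW fin(1), of "\<lambda>v. v"] lin_comb_in_subspace[OF smZ fin(2), of "\<lambda>v. v"] C' BZ by auto
  have "range (lin_comb V (B \<union> C) (\<lambda>v. v)) = Z"
  proof (intro equalityI subsetI)
    fix z assume "z \<in> range (lin_comb V (B \<union> C) (\<lambda>v. v))"
    then obtain a where "z = lin_comb V B (\<lambda>v. v) a \<oplus>\<^bsub>V\<^esub> lin_comb V C (\<lambda>v. v) a"
      unfolding split by blast
    then show "z \<in> Z" using submodule.m_closed[OF smZ cl(2) subsetD[OF WZ cl(1)]] by simp
  next
    fix z assume "z \<in> Z"
    then obtain a c where z: "z = lin_comb V B (\<lambda>v. v) a \<oplus>\<^bsub>V\<^esub> lin_comb V C (\<lambda>v. v) c"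
      using span W_range by blast
    let ?e = "\<lambda>v. if v \<in> C then c v else a v"
    have "lin_comb V C (\<lambda>v. v) ?e = lin_comb V C (\<lambda>v. v) c"
      by (rule lin_comb_cong) (use C' WZ ZV in auto)
    moreover have "lin_comb V B (\<lambda>v. v) ?e = lin_comb V B (\<lambda>v. v) a"
      by (rule lin_comb_cong) (use BZ ZV disj in auto)
    ultimately have "z = lin_comb V (B \<union> C) (\<lambda>v. v) ?e" unfolding split z by simp
    then show "z \<in> range (lin_comb V (B \<union> C) (\<lambda>v. v))" by blast
  qed
  moreover have "a x = 0" if a: "lin_comb V (B \<union> C) (\<lambda>v. v) a = \<zero>\<^bsub>V\<^esub>" and x: "x \<in> B \<union> C" for a x
  proof -
    have eq: "lin_comb V B (\<lambda>v. v) a = lin_comb V C (\<lambda>v. v) a"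
      by (rule add_eq_zero_imp_eq[OF _ _ a[unfolded split]]) (use cl WZ ZV in blast)+
    have B0: "a v = 0" if "v \<in> B" for v
      by (rule indep[of a v]) (simp_all only: eq cl that)
    have "lin_comb V B (\<lambda>v. v) a = \<zero>\<^bsub>V\<^esub>"
      by (rule lin_comb_zero[OF _ B0]) (use BZ ZV in auto)
    then have "lin_comb V C (\<lambda>v. v) a = \<zero>\<^bsub>V\<^esub>" unfolding eq .
    then have "a v = 0" if "v \<in> C" for v
      using basis_family_indep[OF C'(2), of a v] that by blast
    then show ?thesis using B0 x by blast
  qed
  ultimately have "basis_family V Z (B \<union> C) (\<lambda>v. v)" unfolding basis_family_def by blast
  then show "subspace_basis V Z (B \<union> C)"
    using basis_vs_iff[OF Z, of "B \<union> C"] fin BZ C' WZ by (simp add: subspace_basis_def)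
qed

section \<open>Quotient spaces and their bases\<close>

lemma abelian_subgroup_submodule:
  assumes "submodule class_ring W V"
  shows "abelian_subgroup W V"
proof (rule abelian_subgroupI3)
  show "additive_subgroup W V"
  proof (rule additive_subgroup.intro, unfold_locales)
    fix x assume "x \<in> W"
    then show "inv\<^bsub>add_monoid V\<^esub> x \<in> W"
      using minus_eq_self[of x] submodule.subset[OF assms] by (auto simp: a_inv_def)
  qed (use assms submodule.subset[OF assms] submodule.m_closed[OF assms] submodule.zero_closed[OF assms] in auto)
  show "abelian_group V" by unfold_locales
qed

lemma linear_map_quotient:
  assumes W: "submodule class_ring W V"
  shows "linear_map class_ring V (quotient_space V W) (\<lambda>x. W +>\<^bsub>V\<^esub> x)"
    and "carrier (quotient_space V W) = (\<lambda>x. W +>\<^bsub>V\<^esub> x) ` carrier V"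
    and "x \<in> carrier V \<Longrightarrow> W +>\<^bsub>V\<^esub> x = \<zero>\<^bsub>quotient_space V W\<^esub> \<longleftrightarrow> x \<in> W"
proof -
  interpret W: abelian_subgroup W V by (rule abelian_subgroup_submodule[OF W])
  let ?Q = "quotient_space V W" and ?p = "\<lambda>x. W +>\<^bsub>V\<^esub> x"
  have WV: "W \<subseteq> carrier V" by (rule submodule.subset[OF W])
  show car: "carrier ?Q = ?p ` carrier V"
    by (auto simp: quotient_space_def A_RCOSETS_def')
  have zero: "\<zero>\<^bsub>?Q\<^esub> = W" by (simp add: quotient_space_def)
  have p0: "?p \<zero>\<^bsub>V\<^esub> = W" using WV by (simp add: a_coset_add_zero)
  have add: "?p x \<oplus>\<^bsub>?Q\<^esub> ?p y = ?p (x \<oplus>\<^bsub>V\<^esub> y)" if "x \<in> carrier V" "y \<in> carrier V" for x y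
    using W.a_rcos_sum[OF that] by (simp add: quotient_space_def)
  have const: "?p (w \<oplus>\<^bsub>V\<^esub> x) = ?p x" if "w \<in> W" "x \<in> carrier V" for w x
    using W.a_rcos_sum[of w x] that WV W.a_rcos_sum[of "\<zero>\<^bsub>V\<^esub>" x] W.a_rcos_const[OF that(1)] p0 by auto
  \<comment> \<open>Scalar multiplication on cosets is defined as a union over all representatives;
    all these cosets agree, so the union is a single coset.\<close>
  have smult: "c \<odot>\<^bsub>?Q\<^esub> ?p x = ?p (c \<odot>\<^bsub>V\<^esub> x)" if x: "x \<in> carrier V" for c x
  proof -
    have "?p (c \<odot>\<^bsub>V\<^esub> (w \<oplus>\<^bsub>V\<^esub> x)) = ?p (c \<odot>\<^bsub>V\<^esub> x)" if w: "w \<in> W" for w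
    proof -
      have "c \<odot>\<^bsub>V\<^esub> (w \<oplus>\<^bsub>V\<^esub> x) = c \<odot>\<^bsub>V\<^esub> w \<oplus>\<^bsub>V\<^esub> c \<odot>\<^bsub>V\<^esub> x"
        using smult_r_distr w x WV by auto
      then show ?thesis using const[of "c \<odot>\<^bsub>V\<^esub> w"] submodule.smult_closed[OF W] w x by simp
    qed
    moreover have "\<zero>\<^bsub>V\<^esub> \<in> W" by (rule submodule.zero_closed[OF W])
    ultimately show ?thesis
      by (auto simp: quotient_space_def a_r_coset_def' )
  qed
  have "vectorspace class_ring ?Q"
  proof (rule vs_criteria)
    show "field (class_ring :: bit ring)" using vectorspace_axioms unfolding vectorspace_def by blast
    show "\<zero>\<^bsub>?Q\<^esub> \<in> carrier ?Q" unfolding car zero using p0 by blast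
    show "\<forall>v\<in>carrier ?Q. \<exists>w\<in>carrier ?Q. v \<oplus>\<^bsub>?Q\<^esub> w = \<zero>\<^bsub>?Q\<^esub>"
    proof
      fix v assume "v \<in> carrier ?Q"
      then obtain x where "x \<in> carrier V" "v = ?p x" unfolding car by auto
      then have "v \<oplus>\<^bsub>?Q\<^esub> v = \<zero>\<^bsub>?Q\<^esub>" using add add_self p0 zero by simp
      then show "\<exists>w\<in>carrier ?Q. v \<oplus>\<^bsub>?Q\<^esub> w = \<zero>\<^bsub>?Q\<^esub>" using \<open>v \<in> carrier ?Q\<close> by blast
    qed
    show "\<forall>v\<in>carrier ?Q. v \<oplus>\<^bsub>?Q\<^esub> \<zero>\<^bsub>?Q\<^esub> = v"
    proof
      fix v assume "v \<in> carrier ?Q"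
      then obtain x where "x \<in> carrier V" "v = ?p x" unfolding car by auto
      then show "v \<oplus>\<^bsub>?Q\<^esub> \<zero>\<^bsub>?Q\<^esub> = v" using add[of x "\<zero>\<^bsub>V\<^esub>"] p0 zero by simp
    qed
    show "\<forall>v w. v \<in> carrier ?Q \<and> w \<in> carrier ?Q \<longrightarrow> v \<oplus>\<^bsub>?Q\<^esub> w = w \<oplus>\<^bsub>?Q\<^esub> v"
      unfolding car by (auto simp: add a_comm)
    show "\<forall>v w x. v \<in> carrier ?Q \<and> w \<in> carrier ?Q \<and> x \<in> carrier ?Q \<longrightarrow>
        v \<oplus>\<^bsub>?Q\<^esub> w \<oplus>\<^bsub>?Q\<^esub> x = v \<oplus>\<^bsub>?Q\<^esub> (w \<oplus>\<^bsub>?Q\<^esub> x)"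
      unfolding car by (auto simp: add a_assoc)
  qed (auto simp: car add smult smult_class_ring simp del: add_bit_eq_xor mult_bit_eq_and)
  moreover have "?p \<in> LinearCombinations.module_hom class_ring V ?Q"
    unfolding LinearCombinations.module_hom_def mem_Collect_eq
    by (intro conjI ballI allI impI) (auto simp: add smult car)
  ultimately show "linear_map class_ring V ?Q ?p"
    unfolding linear_map_def mod_hom_def mod_hom_axioms_def
    using vectorspace_axioms unfolding vectorspace_def by blast
  show "?p x = \<zero>\<^bsub>?Q\<^esub> \<longleftrightarrow> x \<in> W" if "x \<in> carrier V"
    unfolding zero using W.a_rcos_const that W.a_rcos_self by blast
qed

text \<open>Under the linear projection, lying in \<open>W\<close> becomes being zero. Independence
  and spanning modulo \<open>W\<close> therefore become independence and spanning of the cosets, and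
  distinct elements of \<open>X\<close> have distinct cosets because basis families are
  injective.\<close>

lemma quotient_basis:
  assumes W: "submodule class_ring W V" and X: "finite X" "complement_basis V (carrier V) W X"
  shows "inj_on (\<lambda>x. W +>\<^bsub>V\<^esub> x) X"
    and "vectorspace.basis class_ring (quotient_space V W) ((\<lambda>x. W +>\<^bsub>V\<^esub> x) ` X)"
proof -
  let ?Q = "quotient_space V W" and ?p = "\<lambda>x. W +>\<^bsub>V\<^esub> x"
  interpret linear_map class_ring V ?Q ?p by (rule linear_map_quotient(1)[OF W])
  interpret Q: z2_space ?Q by unfold_locales
  have XV: "X \<subseteq> carrier V" and indep: "\<And>a x. lin_comb V X (\<lambda>v. v) a \<in> W \<Longrightarrow> x \<in> X \<Longrightarrow> a x = 0"
    and span: "\<And>z. z \<in> carrier V \<Longrightarrow> \<exists>a. \<exists>w\<in>W. z = lin_comb V X (\<lambda>v. v) a \<oplus>\<^bsub>V\<^esub> w"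
    using X(2) unfolding complement_basis_def by blast+
  have WV: "W \<subseteq> carrier V" by (rule submodule.subset[OF W])
  have lc: "lin_comb ?Q X ?p a = ?p (lin_comb V X (\<lambda>v. v) a)" for a
    using lin_comb_linear_map[OF linear_map_quotient(1)[OF W] X(1), of "\<lambda>v. v" a] XV by auto
  have cl: "lin_comb V X (\<lambda>v. v) a \<in> carrier V" for a using XV by auto
  have pX: "?p \<in> X \<rightarrow> carrier ?Q" using XV linear_map_quotient(2)[OF W] by auto
  have "range (lin_comb ?Q X ?p) = carrier ?Q"
  proof (intro equalityI subsetI)
    fix v assume "v \<in> carrier ?Q"
    then obtain z where z: "z \<in> carrier V" "v = ?p z" using linear_map_quotient(2)[OF W] by auto
    obtain a w where aw: "w \<in> W" "z = lin_comb V X (\<lambda>v. v) a \<oplus>\<^bsub>V\<^esub> w" using span[OF z(1)] by blast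
    have "v = ?p (lin_comb V X (\<lambda>v. v) a) \<oplus>\<^bsub>?Q\<^esub> ?p w"
      using z aw cl WV T_add by auto
    also have "?p w = \<zero>\<^bsub>?Q\<^esub>" using linear_map_quotient(3)[OF W, of w] aw WV by auto
    finally have "v = lin_comb ?Q X ?p a" using pX by (simp add: lc[symmetric])
    then show "v \<in> range (lin_comb ?Q X ?p)" by blast
  qed (use pX in auto)
  moreover have "a x = 0" if "lin_comb ?Q X ?p a = \<zero>\<^bsub>?Q\<^esub>" "x \<in> X" for a x
    using that indep linear_map_quotient(3)[OF W cl] unfolding lc by blast
  ultimately have "basis_family ?Q (carrier ?Q) X ?p" unfolding basis_family_def by blast
  moreover have "subspace class_ring (carrier ?Q) ?Q"
  proof (rule subspace.intro)
    show vs: "vectorspace class_ring ?Q" by unfold_locales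
    then have "module class_ring ?Q" unfolding vectorspace_def by blast
    then show "submodule class_ring (carrier ?Q) ?Q"
      by (intro submodule.intro) auto
  qed
  ultimately show "inj_on ?p X" "vectorspace.basis class_ring ?Q (?p ` X)"
    using Q.basis_family_iff[OF _ X(1) pX] by auto
qed

end

section \<open>Transport along the injection\<close>

lemma linear_map_z2_space:
  fixes V :: "(bit, 'v) module" and W :: "(bit, 'w) module"
  assumes "linear_map class_ring V W T"
  shows "z2_space V" "z2_space W"
  using assms unfolding linear_map_def z2_space_def field_space_def by blast+

context cochain_complex
begin

lemma z2_space: "z2_space (V n)"
  by (rule linear_map_z2_space(1)[OF d_linear])

lemma cocycles_subspace: "subspace class_ring (cocycles V d i) (V i)"
proof -
  interpret linear_map class_ring "V i" "V (Suc i)" "d i" by (rule d_linear)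
  show ?thesis using kerT_is_subspace by (simp add: cocycles_def ker_def)
qed

lemma coboundaries_subspace: "subspace class_ring (coboundaries V d i) (V i)"
proof (cases i)
  case 0
  interpret z2_space "V 0" by (rule z2_space)
  have "subspace class_ring (span {}) (V 0)" by (rule span_is_subspace) simp
  then show ?thesis unfolding span_empty by (simp add: 0 coboundaries_def)
next
  case (Suc j)
  interpret linear_map class_ring "V j" "V (Suc j)" "d j" by (rule d_linear)
  show ?thesis using imT_is_subspace by (simp add: Suc coboundaries_def im_def)
qed

lemma coboundaries_subset_cocycles: "coboundaries V d i \<subseteq> cocycles V d i"
proof (cases i)
  case 0
  interpret linear_map class_ring "V 0" "V (Suc 0)" "d 0" by (rule d_linear)
  show ?thesis by (simp add: 0 coboundaries_def cocycles_def)
next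
  case (Suc j)
  interpret linear_map class_ring "V j" "V (Suc j)" "d j" by (rule d_linear)
  show ?thesis using d_d by (auto simp: Suc coboundaries_def cocycles_def)
qed

text \<open>Cohomology is a quotient of the space of cocycles, while complements are computed in all
  of \<open>V i\<close>. Restricting the carrier changes neither the linear combinations of cocycles
  nor the cosets.\<close>

lemma representative_cocycle_basis_of_complement:
  assumes X: "finite X" "complement_basis (V i) (cocycles V d i) (coboundaries V d i) X"
  shows "representative_cocycle_basis V d i X"
proof -
  let ?Z = "cocycles V d i" and ?B = "coboundaries V d i"
  interpret z2_space "V i" by (rule z2_space)
  interpret Z: vectorspace class_ring "vs ?Z" by (rule subspace_is_vs[OF cocycles_subspace])
  interpret Z: z2_space "vs ?Z" by unfold_locales
  have B: "submodule class_ring ?B (V i)" by (rule is_module[OF coboundaries_subspace])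
  have BZ: "submodule class_ring ?B (vs ?Z)"
  proof (rule submodule.intro)
    show "module class_ring (vs ?Z)" by unfold_locales
  qed (use coboundaries_subset_cocycles submodule.m_closed[OF B] submodule.zero_closed[OF B]
      submodule.smult_closed[OF B] in auto)
  have XZ: "X \<subseteq> ?Z" using X(2) by (simp add: complement_basis_def)
  have lc: "lin_comb (vs ?Z) X (\<lambda>x. x) a = lin_comb (V i) X (\<lambda>x. x) a" for a
    by (rule lin_comb_vs[OF cocycles_subspace X(1)]) (use XZ in auto)
  have "complement_basis (vs ?Z) (carrier (vs ?Z)) ?B X"
    using X(2) unfolding complement_basis_def lc by simp
  note qb = Z.quotient_basis[OF BZ X(1) this]
  have "(+>\<^bsub>vs ?Z\<^esub>) ?B = cohomology_class V d i"
    by (auto simp: cohomology_class_def a_r_coset_def r_coset_def)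
  then show ?thesis
    using qb XZ unfolding representative_cocycle_basis_def cohomology_def by simp
qed

end

context contraction
begin

lemma complement_basis_injection:
  assumes i: "i \<ge> 1" and X: "finite X" "complement_basis (M i) (cocycles M dM i) (coboundaries M dM i) X"
  shows "complement_basis (N i) (cocycles N dN i) (coboundaries N dN i) (K i ` X)"
proof -
  obtain j where i: "i = Suc j" using i by (cases i) auto
  interpret Mi: z2_space "M i" by (rule M.z2_space)
  interpret Ni: z2_space "N i" by (rule N.z2_space)
  interpret Nj: z2_space "N j" by (rule N.z2_space)
  interpret K: linear_map class_ring "M i" "N i" "K i" by (rule K_linear)
  interpret F: linear_map class_ring "N i" "M i" "F i" by (rule F_linear)
  interpret dN: linear_map class_ring "N j" "N i" "dN j" unfolding i by (rule N.d_linear)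
  have XZ: "X \<subseteq> cocycles M dM i"
    and indep: "\<And>a x. lin_comb (M i) X (\<lambda>v. v) a \<in> coboundaries M dM i \<Longrightarrow> x \<in> X \<Longrightarrow> a x = 0"
    and span: "\<And>z. z \<in> cocycles M dM i \<Longrightarrow>
      \<exists>a. \<exists>w\<in>coboundaries M dM i. z = lin_comb (M i) X (\<lambda>v. v) a \<oplus>\<^bsub>M i\<^esub> w"
    using X(2) unfolding complement_basis_def by blast+
  have XM: "X \<subseteq> carrier (M i)" using XZ by (auto simp: cocycles_def)
  have inj: "inj_on (K i) X" using XM F_K by (metis inj_on_def subsetD)
  have KX: "K i ` X \<subseteq> carrier (N i)" using XM by auto
  have lc: "lin_comb (N i) (K i ` X) (\<lambda>v. v) a = K i (lin_comb (M i) X (\<lambda>v. v) (\<lambda>x. a (K i x)))" for a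
  proof -
    have "lin_comb (N i) (K i ` X) (\<lambda>v. v) a = lin_comb (N i) X (K i) (\<lambda>x. a (K i x))"
      by (rule Ni.lin_comb_reindex[OF inj]) (use KX in auto)
    also have "\<dots> = K i (lin_comb (M i) X (\<lambda>v. v) (\<lambda>x. a (K i x)))"
      by (rule lin_comb_linear_map[OF K_linear X(1), symmetric]) (use XM in auto)
    finally show ?thesis .
  qed
  have cl: "lin_comb (M i) X (\<lambda>v. v) a \<in> carrier (M i)" for a using XM by auto
  show ?thesis unfolding complement_basis_def
  proof (intro conjI allI impI ballI)
    interpret K': linear_map class_ring "M (Suc i)" "N (Suc i)" "K (Suc i)" by (rule K_linear)
    show "K i ` X \<subseteq> cocycles N dN i"
    proof
      fix y assume "y \<in> K i ` X"
      then obtain x where x: "x \<in> X" "y = K i x" by auto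
      then have "dN i y = K (Suc i) (dM i x)" using XM K_cochain[of x i] by auto
      also have "dM i x = \<zero>\<^bsub>M (Suc i)\<^esub>" using x XZ by (auto simp: cocycles_def)
      finally show "y \<in> cocycles N dN i" using x KX by (auto simp: cocycles_def)
    qed
  next
    fix a x assume a: "lin_comb (N i) (K i ` X) (\<lambda>v. v) a \<in> coboundaries N dN i" and x: "x \<in> K i ` X"
    then obtain u where u: "u \<in> carrier (N j)" "lin_comb (N i) (K i ` X) (\<lambda>v. v) a = dN j u"
      by (auto simp: coboundaries_def i)
    interpret Fj: linear_map class_ring "N j" "M j" "F j" by (rule F_linear)
    have "lin_comb (M i) X (\<lambda>v. v) (\<lambda>x. a (K i x)) = F i (dN j u)"
      unfolding u(2)[symmetric] lc using F_K cl by simp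
    also have "\<dots> = dM j (F j u)" unfolding i by (rule F_cochain[OF u(1)])
    also have "\<dots> \<in> coboundaries M dM i" using u by (simp add: coboundaries_def i)
    finally have "\<And>x. x \<in> X \<Longrightarrow> a (K i x) = 0" by (rule indep)
    then show "a x = 0" using x by auto
  next
    fix z assume z: "z \<in> cocycles N dN i"
    interpret F': linear_map class_ring "N (Suc i)" "M (Suc i)" "F (Suc i)" by (rule F_linear)
    interpret ph: linear_map class_ring "N i" "N j" "\<phi> j" unfolding i by (rule phi_linear)
    interpret ph': linear_map class_ring "N (Suc i)" "N i" "\<phi> i" by (rule phi_linear)
    interpret Kj: linear_map class_ring "M j" "N j" "K j" by (rule K_linear)
    have zN: "z \<in> carrier (N i)" and dz: "dN i z = \<zero>\<^bsub>N (Suc i)\<^esub>" using z by (auto simp: cocycles_def)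
    have "F i z \<in> cocycles M dM i"
      using F_cochain[OF zN] zN dz by (simp add: cocycles_def)
    then obtain a w where aw: "w \<in> coboundaries M dM i" "F i z = lin_comb (M i) X (\<lambda>v. v) a \<oplus>\<^bsub>M i\<^esub> w"
      using span by blast
    then obtain u where u: "u \<in> carrier (M j)" "w = dM j u" by (auto simp: coboundaries_def i)
    interpret dM: linear_map class_ring "M j" "M i" "dM j" unfolding i by (rule M.d_linear)
    have wM: "w \<in> carrier (M i)" using u by simp
    let ?b = "\<lambda>y. a (inv_into X (K i) y)"
    have "lin_comb (M i) X (\<lambda>v. v) (\<lambda>x. ?b (K i x)) = lin_comb (M i) X (\<lambda>v. v) a"
      by (rule Mi.lin_comb_cong) (use XM inj in auto)
    then have lb: "lin_comb (N i) (K i ` X) (\<lambda>v. v) ?b = K i (lin_comb (M i) X (\<lambda>v. v) a)"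
      unfolding lc by simp
    have "K i (F i z) = lin_comb (N i) (K i ` X) (\<lambda>v. v) ?b \<oplus>\<^bsub>N i\<^esub> dN j (K j u)"
    proof -
      have "K i w = dN j (K j u)" unfolding u(2) i by (rule K_cochain[OF u(1)])
      then show ?thesis unfolding aw(2) lb using cl wM by simp
    qed
    moreover have "z \<ominus>\<^bsub>N i\<^esub> K i (F i z) = dN j (\<phi> j z)"
      using homotopy_Suc[of z j] zN dz by (simp add: i[symmetric])
    moreover have "z = K i (F i z) \<oplus>\<^bsub>N i\<^esub> (z \<ominus>\<^bsub>N i\<^esub> K i (F i z))"
    proof -
      have "K i (F i z) \<oplus>\<^bsub>N i\<^esub> (z \<oplus>\<^bsub>N i\<^esub> K i (F i z)) = z \<oplus>\<^bsub>N i\<^esub> (K i (F i z) \<oplus>\<^bsub>N i\<^esub> K i (F i z))"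
        using zN by (intro Ni.a_lcomm) auto
      then show ?thesis using Ni.add_self Ni.minus_eq_self zN by (simp add: a_minus_def)
    qed
    \<comment> \<open>Two corrections by coboundaries arise: one from \<open>w\<close> through
      \<open>K\<close>, one from the homotopy. They are merged below into the coboundary of the
      single cochain formed from \<open>K j u\<close> and \<open>\<phi> j z\<close>.\<close>
    ultimately have "z = lin_comb (N i) (K i ` X) (\<lambda>v. v) ?b \<oplus>\<^bsub>N i\<^esub> dN j (K j u) \<oplus>\<^bsub>N i\<^esub> dN j (\<phi> j z)"
      by simp
    also have "\<dots> = lin_comb (N i) (K i ` X) (\<lambda>v. v) ?b \<oplus>\<^bsub>N i\<^esub> (dN j (K j u) \<oplus>\<^bsub>N i\<^esub> dN j (\<phi> j z))"
      using KX u(1) zN by (intro Ni.a_assoc Ni.lin_comb_closed) auto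
    also have "dN j (K j u) \<oplus>\<^bsub>N i\<^esub> dN j (\<phi> j z) = dN j (K j u \<oplus>\<^bsub>N j\<^esub> \<phi> j z)"
      using u(1) zN by simp
    finally show "\<exists>a. \<exists>w\<in>coboundaries N dN i. z = lin_comb (N i) (K i ` X) (\<lambda>v. v) a \<oplus>\<^bsub>N i\<^esub> w"
    proof (intro exI[of _ ?b] bexI)
      have "K j u \<oplus>\<^bsub>N j\<^esub> \<phi> j z \<in> carrier (N j)" using u(1) zN by simp
      then show "dN j (K j u \<oplus>\<^bsub>N j\<^esub> \<phi> j z) \<in> coboundaries N dN i"
        by (simp add: coboundaries_def i)
    qed
  qed
qed

end

section \<open>The coboundary step\<close>

lemma cochains_simps:
  shows carrier_cochains: "carrier (cochains G n) = symbols G n \<rightarrow>\<^sub>E UNIV"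
    and zero_cochains: "\<zero>\<^bsub>cochains G n\<^esub> = (\<lambda>hs\<in>symbols G n. 0)"
    and add_cochains: "f \<oplus>\<^bsub>cochains G n\<^esub> g = (\<lambda>hs\<in>symbols G n. f hs + g hs)"
    and smult_cochains: "c \<odot>\<^bsub>cochains G n\<^esub> f = (\<lambda>hs\<in>symbols G n. c * f hs)"
proof -
  have r: "ring (class_ring :: bit ring)" by (rule class_ring.ring_axioms)
  show "carrier (cochains G n) = symbols G n \<rightarrow>\<^sub>E UNIV"
    and "\<zero>\<^bsub>cochains G n\<^esub> = (\<lambda>hs\<in>symbols G n. 0)"
    and "f \<oplus>\<^bsub>cochains G n\<^esub> g = (\<lambda>hs\<in>symbols G n. f hs + g hs)"
    and "c \<odot>\<^bsub>cochains G n\<^esub> f = (\<lambda>hs\<in>symbols G n. c * f hs)"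
    unfolding cochains_def ring.func_space_def[OF r] by simp_all
qed

lemma lin_comb_cochains_apply:
  assumes "z2_space (cochains G n)" "finite I" "x \<in> I \<rightarrow> carrier (cochains G n)" "hs \<in> symbols G n"
  shows "lin_comb (cochains G n) I x a hs = (\<Sum>i\<in>I. a i * x i hs)"
proof -
  interpret z2_space "cochains G n" by fact
  show ?thesis
    using assms(2,3)
  proof (induction I)
    case empty
    then show ?case using assms(4) by (simp add: zero_cochains)
  next
    case (insert i I)
    then show ?case
      using assms(4) lin_comb_insert[of I i x a]
      by (simp add: add_cochains smult_cochains del: add_bit_eq_xor mult_bit_eq_and)
  qed
qed

lemma cochains_eqI:
  assumes "f \<in> carrier (cochains G n)" "g \<in> carrier (cochains G n)"
    and "\<And>hs. hs \<in> symbols G n \<Longrightarrow> f hs = g hs"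
  shows "f = g"
  using assms unfolding carrier_cochains by (metis PiE_ext)

lemma enumerates_nth:
  assumes "enumerates xs A"
  shows "a < length xs \<Longrightarrow> xs ! a \<in> A"
    and "x \<in> A \<Longrightarrow> \<exists>a<length xs. x = xs ! a"
  using assms unfolding enumerates_def by (auto simp: in_set_conv_nth)

text \<open>At a symbol \<open>rs ! b\<close> only the summand for \<open>b\<close> survives,
  because \<open>rs\<close> has no repetitions. Applying the codifferential then shows that the
  elementary coboundaries span all coboundaries.\<close>

lemma cochain_eq_lin_comb_characteristic:
  assumes z2: "z2_space (cochains G n)" and rs: "enumerates rs (symbols G n)"
    and f: "f \<in> carrier (cochains G n)"
  shows "f = lin_comb (cochains G n) {..<length rs} (\<lambda>a. characteristic_map G (rs ! a)) (\<lambda>a. f (rs ! a))"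
proof (rule cochains_eqI[OF f])
  interpret z2_space "cochains G n" by fact
  have len: "length (rs ! a) = n" if "a < length rs" for a
    using enumerates_nth(1)[OF rs that] by (simp add: symbols_def)
  then have ch: "(\<lambda>a. characteristic_map G (rs ! a)) \<in> {..<length rs} \<rightarrow> carrier (cochains G n)"
    by (auto simp: carrier_cochains characteristic_map_def)
  then show "lin_comb (cochains G n) {..<length rs} (\<lambda>a. characteristic_map G (rs ! a)) (\<lambda>a. f (rs ! a)) \<in> carrier (cochains G n)"
    by auto
  fix hs assume hs: "hs \<in> symbols G n"
  then obtain b where b: "b < length rs" "hs = rs ! b" using enumerates_nth(2)[OF rs] by blast
  have "lin_comb (cochains G n) {..<length rs} (\<lambda>a. characteristic_map G (rs ! a)) (\<lambda>a. f (rs ! a)) hs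
      = (\<Sum>a<length rs. f (rs ! a) * characteristic_map G (rs ! a) hs)"
    by (rule lin_comb_cochains_apply[OF z2 _ ch hs]) simp
  also have "\<dots> = (\<Sum>a<length rs. if a = b then f (rs ! b) else 0)"
  proof (rule sum.cong[OF refl])
    fix a assume "a \<in> {..<length rs}"
    then have a: "a < length rs" by simp
    then have "rs ! b = rs ! a \<longleftrightarrow> a = b"
      using rs b unfolding enumerates_def by (metis nth_eq_iff_index_eq)
    then show "f (rs ! a) * characteristic_map G (rs ! a) hs = (if a = b then f (rs ! b) else 0)"
      using hs b len[OF a] by (simp add: characteristic_map_def)
  qed
  also have "\<dots> = f hs" using b by simp
  finally show "f hs = lin_comb (cochains G n) {..<length rs} (\<lambda>a. characteristic_map G (rs ! a)) (\<lambda>a. f (rs ! a)) hs" ..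
qed

lemma card_symbols:
  assumes "finite (carrier G)" "Coset.order G = 4 * t"
  shows "finite (symbols G n)" "card (symbols G n) = 4 ^ n * t ^ n"
proof -
  have "symbols G n = {gs. set gs \<subseteq> carrier G \<and> length gs = n}" by (auto simp: symbols_def)
  then show "finite (symbols G n)" "card (symbols G n) = 4 ^ n * t ^ n"
    using assms finite_lists_length_eq[of "carrier G" n] card_lists_length_eq[of "carrier G" n]
    by (simp_all add: Coset.order_def power_mult_distrib)
qed

text \<open>Row \<open>a\<close> of the matrix lists the values of the elementary coboundary
  \<open>x a\<close> at every symbol. A cochain is determined by these values, so linear relations
  between rows are exactly relations between coboundaries.\<close>

lemma coboundary_step_basis:
  assumes cc: "cochain_complex (cochains G) (codifferential G)"
    and fin: "finite (carrier G)" and ord: "Coset.order G = 4 * t" and i: "i \<ge> 1"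
    and rs: "enumerates rs (symbols G (i - 1))" and cs: "enumerates cs (symbols G i)"
    and step: "coboundary_step G t i rs cs E"
  shows "finite E" "subspace_basis (cochains G i) (coboundaries (cochains G) (codifferential G) i) E"
proof -
  obtain j where j: "i = Suc j" using i by (cases i) auto
  interpret cochain_complex "cochains G" "codifferential G" by fact
  interpret Vi: z2_space "cochains G i" by (rule z2_space)
  interpret d: linear_map class_ring "cochains G j" "cochains G i" "codifferential G j"
    unfolding j by (rule d_linear)
  let ?W = "coboundaries (cochains G) (codifferential G) i"
  define C where "C = coboundary_matrix G t i rs cs"
  define x where "x = (\<lambda>a. elementary_coboundary G (rs ! a))"
  have rsj: "enumerates rs (symbols G j)" using rs j by simp
  \<comment> \<open>The prescribed powers of 4 and \<open>t\<close> count the symbols, so the index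
    range of the matrix matches the two lists.\<close>
  have len: "length rs = 4 ^ (i - 1) * t ^ (i - 1)" "length cs = 4 ^ i * t ^ i"
    using rs cs card_symbols[OF fin ord] distinct_card[of rs] distinct_card[of cs]
    unfolding enumerates_def by simp_all
  have dim: "dim_row C = length rs" "dim_col C = length cs"
    by (simp_all add: C_def coboundary_matrix_def len)
  have C_index: "C $$ (a, b) = x a (cs ! b)" if "a < length rs" "b < length cs" for a b
    using that by (simp add: C_def coboundary_matrix_def len x_def)
  have length_rs: "length (rs ! a) = j" if "a < length rs" for a
    using enumerates_nth(1)[OF rsj that] by (simp add: symbols_def)
  have ch: "(\<lambda>a. characteristic_map G (rs ! a)) \<in> {..<length rs} \<rightarrow> carrier (cochains G j)"
    using length_rs by (auto simp: carrier_cochains characteristic_map_def)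
  have x: "x a = codifferential G j (characteristic_map G (rs ! a))" if "a < length rs" for a
    using length_rs[OF that] by (simp add: x_def elementary_coboundary_def)
  have xW: "x \<in> {..<length rs} \<rightarrow> ?W"
    using x ch by (auto simp: coboundaries_def j Pi_iff)
  have W: "subspace class_ring ?W (cochains G i)" by (rule coboundaries_subspace)
  have WV: "?W \<subseteq> carrier (cochains G i)" by (rule submodule.subset[OF Vi.is_module[OF W]])
  obtain R where R: "row_reduction C R"
    and E: "E = {x a | a. a < dim_row R \<and> row R a \<noteq> 0\<^sub>v (dim_col R)}"
    using step unfolding coboundary_step_def C_def x_def by blast
  obtain S where S: "S \<subseteq> {..<dim_row C}" "{a. a < dim_row R \<and> row R a \<noteq> 0\<^sub>v (dim_col R)} = S"
    and indep: "\<And>v. (\<And>b. b < dim_col C \<Longrightarrow> row_comb C S v b = 0) \<Longrightarrow> \<forall>s\<in>S. v s = 0"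
    and span: "\<And>a. a < dim_row C \<Longrightarrow> \<exists>v. \<forall>b<dim_col C. C $$ (a, b) = row_comb C S v b"
    using row_reduction_pivot_rows[OF R] by blast
  have ES: "E = x ` S" unfolding E S(2)[symmetric] by blast
  have finS: "finite S" using S(1) finite_subset by blast
  have SN: "S \<subseteq> {..<length rs}" using S(1) dim by simp
  have xS: "x \<in> S \<rightarrow> carrier (cochains G i)" using xW WV SN by auto
  have lc: "lin_comb (cochains G i) S x v (cs ! b) = row_comb C S v b" if b: "b < length cs" for v b
  proof -
    have "lin_comb (cochains G i) S x v (cs ! b) = (\<Sum>s\<in>S. v s * x s (cs ! b))"
      by (rule lin_comb_cochains_apply[OF z2_space finS xS enumerates_nth(1)[OF cs b]])
    also have "\<dots> = row_comb C S v b"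
      unfolding row_comb_def using C_index SN b by (intro sum.cong) auto
    finally show ?thesis .
  qed
  have "v s = 0" if "lin_comb (cochains G i) S x v = \<zero>\<^bsub>cochains G i\<^esub>" "s \<in> S" for v s
  proof -
    have "row_comb C S v b = 0" if "b < dim_col C" for b
      using lc[of b v] that dim enumerates_nth(1)[OF cs, of b]
      unfolding \<open>lin_comb (cochains G i) S x v = _\<close> zero_cochains by simp
    then show ?thesis using indep[of v] that(2) by blast
  qed
  moreover have "range (lin_comb (cochains G i) S x) = ?W"
  proof (intro equalityI subsetI)
    fix g assume "g \<in> range (lin_comb (cochains G i) S x)"
    then show "g \<in> ?W"
      using Vi.lin_comb_in_subspace[OF Vi.is_module[OF W] finS, of x] xW SN by auto
  next
    fix g assume "g \<in> ?W"
    then obtain f where f: "f \<in> carrier (cochains G j)" "g = codifferential G j f"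
      by (auto simp: coboundaries_def j)
    define c where "c = (\<lambda>a. f (rs ! a))"
    obtain u where u: "\<And>a b. a < length rs \<Longrightarrow> b < length cs \<Longrightarrow> C $$ (a, b) = row_comb C S (u a) b"
      using span unfolding dim by metis
    have xu: "x a = lin_comb (cochains G i) S x (u a)" if a: "a < length rs" for a
    proof (rule cochains_eqI)
      show "x a \<in> carrier (cochains G i)" using xW WV a by auto
      show "lin_comb (cochains G i) S x (u a) \<in> carrier (cochains G i)" using xS by simp
      fix hs assume "hs \<in> symbols G i"
      then obtain b where b: "b < length cs" "hs = cs ! b" using enumerates_nth(2)[OF cs] by blast
      then show "x a hs = lin_comb (cochains G i) S x (u a) hs"
        using C_index[OF a b(1)] u[OF a b(1)] lc[OF b(1)] by simp
    qed
    \<comment> \<open>A coboundary is expanded in two stages: first over all elementary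
      coboundaries, then each of these over the pivot rows.\<close>
    have "g = codifferential G j (lin_comb (cochains G j) {..<length rs} (\<lambda>a. characteristic_map G (rs ! a)) c)"
      unfolding f(2) c_def
      using cochain_eq_lin_comb_characteristic[OF z2_space rsj f(1)] by simp
    also have "\<dots> = lin_comb (cochains G i) {..<length rs} (\<lambda>a. codifferential G j (characteristic_map G (rs ! a))) c"
      unfolding j by (rule lin_comb_linear_map[OF d_linear _ ch]) simp
    also have "\<dots> = lin_comb (cochains G i) {..<length rs} (\<lambda>a. lin_comb (cochains G i) S x (u a)) c"
      by (rule Vi.lin_comb_cong) (use x xu xW WV in \<open>auto simp: Pi_iff\<close>)
    also have "\<dots> = lin_comb (cochains G i) S x (\<lambda>s. \<Sum>a<length rs. c a * u a s)"
      by (rule Vi.lin_comb_lin_comb[OF finS _ xS]) simp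
    finally show "g \<in> range (lin_comb (cochains G i) S x)" by blast
  qed
  ultimately have "basis_family (cochains G i) ?W S x" unfolding basis_family_def by blast
  then show "subspace_basis (cochains G i) ?W E"
    unfolding ES subspace_basis_def using Vi.basis_family_iff[OF W finS xS] by simp
  show "finite E" unfolding ES using finS by simp
qed

section \<open>The cocycle step\<close>

lemma from_coordinates_eq_lin_comb:
  "from_coordinates V us v = lin_comb V {..<length us} ((!) us) (($) v)"
  by (simp add: from_coordinates_def lin_comb_def)

lemma ordered_basis_family:
  assumes "z2_space V" "ordered_basis V us"
  shows "basis_family V (carrier V) {..<length us} ((!) us)" "(!) us \<in> {..<length us} \<rightarrow> carrier V"
proof -
  interpret z2_space V by fact
  have b: "basis (set us)" and dist: "distinct us" using assms(2) by (simp_all add: ordered_basis_def)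
  have "set us \<subseteq> carrier V" using b unfolding basis_def by blast
  then show us: "(!) us \<in> {..<length us} \<rightarrow> carrier V"
    by (intro Pi_I) (auto dest: nth_mem)
  have set: "(!) us ` {..<length us} = set us" by (auto simp: set_conv_nth)
  have "inj_on ((!) us) {..<length us}" using dist by (auto simp: inj_on_def nth_eq_iff_index_eq)
  moreover have "subspace class_ring (carrier V) V"
  proof (rule subspace.intro)
    show "vectorspace class_ring V" by unfold_locales
    show "submodule class_ring (carrier V) V" by (intro submodule.intro module_axioms) auto
  qed
  ultimately show "basis_family V (carrier V) {..<length us} ((!) us)"
    using basis_family_iff[OF _ _ us] b set by simp
qed

lemma matrix_of_map_exists:
  assumes "linear_map class_ring V W f" "z2_space W" "ordered_basis V us" "ordered_basis W ws"
  shows "\<exists>A. matrix_of_map W f us ws A"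
proof -
  interpret linear_map class_ring V W f by fact
  interpret V: z2_space V by unfold_locales
  note b = ordered_basis_family[OF assms(2,4)]
  have "\<exists>a. f (us ! j) = lin_comb W {..<length ws} ((!) ws) a" if "j < length us" for j
  proof -
    have "us ! j \<in> carrier V"
      using ordered_basis_family(2)[OF V.z2_space_axioms assms(3)] that by auto
    then have "f (us ! j) \<in> carrier W" by simp
    then show ?thesis using b(1) unfolding basis_family_def by blast
  qed
  then obtain a where a: "\<And>j. j < length us \<Longrightarrow> f (us ! j) = lin_comb W {..<length ws} ((!) ws) (a j)"
    by metis
  interpret W: z2_space W by fact
  have "matrix_of_map W f us ws (mat (length us) (length ws) (\<lambda>(j, k). a j k))"
    unfolding matrix_of_map_def from_coordinates_eq_lin_comb
    using a by (auto intro!: W.lin_comb_cong[OF b(2)])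
  then show ?thesis ..
qed

lemma (in z2_space) from_coordinates_row:
  assumes "ordered_basis V es" "P \<in> carrier_mat n (length es)" "j < n"
  shows "from_coordinates V es (row P j) = lin_comb V {..<length es} ((!) es) (\<lambda>k. P $$ (j, k))"
  unfolding from_coordinates_eq_lin_comb
  by (rule lin_comb_cong[OF ordered_basis_family(2)[OF z2_space_axioms assms(1)]])
    (use assms in auto)

context cochain_complex
begin

lemma smith_step_exists:
  assumes i: "i \<ge> 1" and us: "ordered_basis (V (i - 1)) us" and es: "ordered_basis (V i) es"
    and vs: "ordered_basis (V (Suc i)) vs"
  shows "\<exists>Cbar Dbar n. smith_step V d i us es vs Cbar Dbar n"
proof -
  have lin: "linear_map class_ring (V (i - 1)) (V i) (d (i - 1))" using d_linear[of "i - 1"] i by simp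
  obtain A where A: "matrix_of_map (V i) (d (i - 1)) us es A"
    using matrix_of_map_exists[OF lin z2_space us es] by blast
  obtain A' where A': "matrix_of_map (V (Suc i)) (d i) es vs A'"
    using matrix_of_map_exists[OF d_linear z2_space es vs] by blast
  obtain P Q l where snf: "smith_normal_form A P Q l" using smith_normal_form_exists by blast
  obtain P' Q' k where snf': "smith_normal_form A' P' Q' k" using smith_normal_form_exists by blast
  have Q: "Q \<in> carrier_mat (length es) (length es)" "invertible_mat Q"
    using snf A unfolding smith_normal_form_def matrix_of_map_def by auto
  obtain Qinv where Qinv: "Qinv \<in> carrier_mat (length es) (length es)"
      "Q * Qinv = 1\<^sub>m (length es)" "Qinv * Q = 1\<^sub>m (length es)"
    using invertible_mat_obtain[OF Q(2,1)] by blast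
  then have "inverts_mat Q Qinv" "inverts_mat Qinv Q" using Q by (auto simp: inverts_mat_def)
  then show ?thesis
    unfolding smith_step_def using A A' snf snf' Qinv(1) by blast
qed

text \<open>The two Smith forms are used for different halves: the form of the incoming matrix for
  the image of \<open>d (i - 1)\<close>, that of the outgoing matrix for the kernel of
  \<open>d i\<close>.\<close>

lemma smith_step_bases:
  assumes i: "i \<ge> 1" and us: "ordered_basis (V (i - 1)) us" and es: "ordered_basis (V i) es"
    and vs: "ordered_basis (V (Suc i)) vs"
    and step: "smith_step V d i us es vs Cbar Dbar n"
  shows "finite Cbar" "finite Dbar" "subspace_basis (V i) (coboundaries V d i) Cbar"
    and "subspace_basis (V i) (cocycles V d i) Dbar" "n = card Dbar - card Cbar"
proof -
  obtain A A' P Q Qinv P' Q' l k where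
    A: "matrix_of_map (V i) (d (i - 1)) us es A" and A': "matrix_of_map (V (Suc i)) (d i) es vs A'"
    and snf: "smith_normal_form A P Q l" and snf': "smith_normal_form A' P' Q' k"
    and Qinv: "Qinv \<in> carrier_mat (length es) (length es)" "inverts_mat Q Qinv" "inverts_mat Qinv Q"
    and Cbar: "Cbar = {from_coordinates (V i) es (row Qinv j) | j. j < l}"
    and Dbar: "Dbar = {from_coordinates (V i) es (row P' j) | j. k \<le> j \<and> j < length es}"
    and n: "n = length es - k - l"
    using step unfolding smith_step_def by blast
  interpret z2_space "V i" by (rule z2_space)
  have lin: "linear_map class_ring (V (i - 1)) (V i) (d (i - 1))" using d_linear[of "i - 1"] i by simp
  let ?es = "\<lambda>M j. lin_comb (V i) {..<length es} ((!) es) (\<lambda>k. M $$ (j, k))"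
  note bu = ordered_basis_family[OF z2_space us] and be = ordered_basis_family[OF z2_space es]
    and bv = ordered_basis_family[OF z2_space vs]
  have Ac: "A \<in> carrier_mat (length us) (length es)" and Ac': "A' \<in> carrier_mat (length es) (length vs)"
    using A A' unfolding matrix_of_map_def by auto
  have dA: "d (i - 1) (us ! j) = lin_comb (V i) {..<length es} ((!) es) (\<lambda>k. A $$ (j, k))" if "j < length us" for j
    using A that from_coordinates_row[OF es Ac that] unfolding matrix_of_map_def by simp
  have dA': "d i (es ! j) = lin_comb (V (Suc i)) {..<length vs} ((!) vs) (\<lambda>k. A' $$ (j, k))" if "j < length es" for j
    using A' that z2_space.from_coordinates_row[OF z2_space vs Ac' that] unfolding matrix_of_map_def by simp
  have P': "P' \<in> carrier_mat (length es) (length es)" and l: "l \<le> length es" and k: "k \<le> length es"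
    using snf snf' Ac Ac' unfolding smith_normal_form_def by auto
  \<comment> \<open>\<open>smith_step\<close> names only the inverse of \<open>Q\<close>. For the
    outgoing matrix an inverse of \<open>Q'\<close> is supplied here, so that the general statement
    on adapted bases applies.\<close>
  obtain Q'inv where Q'inv: "Q'inv \<in> carrier_mat (length vs) (length vs)" "inverts_mat Q' Q'inv" "inverts_mat Q'inv Q'"
  proof -
    have Q': "Q' \<in> carrier_mat (length vs) (length vs)" "invertible_mat Q'"
      using snf' Ac' unfolding smith_normal_form_def by auto
    obtain B where "B \<in> carrier_mat (length vs) (length vs)" "Q' * B = 1\<^sub>m (length vs)" "B * Q' = 1\<^sub>m (length vs)"
      using invertible_mat_obtain[OF Q'(2,1)] by blast
    then show ?thesis using that[of B] Q' by (auto simp: inverts_mat_def)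
  qed
  have im: "basis_family (V i) (coboundaries V d i) {..<l} (?es Qinv)"
    using smith_adapted_bases(1)[OF lin bu be Ac dA snf Qinv] i by (simp add: coboundaries_def)
  have ker: "basis_family (V i) (cocycles V d i) {k..<length es} (?es P')"
    using smith_adapted_bases(2)[OF d_linear be bv Ac' dA' snf' Q'inv] by (simp add: cocycles_def)
  have esM: "?es M \<in> J \<rightarrow> carrier (V i)" for M J using be(2) by auto
  have C: "Cbar = ?es Qinv ` {..<l}"
  proof -
    have "Cbar = (\<lambda>j. from_coordinates (V i) es (row Qinv j)) ` {..<l}" unfolding Cbar by auto
    then show ?thesis using from_coordinates_row[OF es Qinv(1)] l by simp
  qed
  have D: "Dbar = ?es P' ` {k..<length es}"
  proof -
    have "Dbar = (\<lambda>j. from_coordinates (V i) es (row P' j)) ` {k..<length es}" unfolding Dbar by auto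
    then show ?thesis using from_coordinates_row[OF es P'] by simp
  qed
  have im': "inj_on (?es Qinv) {..<l}" "subspace_basis (V i) (coboundaries V d i) Cbar"
    using basis_family_iff[OF coboundaries_subspace _ esM, of "{..<l}" Qinv] im
    unfolding C subspace_basis_def by simp_all
  have ker': "inj_on (?es P') {k..<length es}" "subspace_basis (V i) (cocycles V d i) Dbar"
    using basis_family_iff[OF cocycles_subspace _ esM, of "{k..<length es}" P'] ker
    unfolding D subspace_basis_def by simp_all
  show "finite Cbar" "finite Dbar" unfolding C D by simp_all
  show "subspace_basis (V i) (coboundaries V d i) Cbar" "subspace_basis (V i) (cocycles V d i) Dbar"
    by (fact im'(2) ker'(2))+
  \<comment> \<open>Because the families are injective, passing to sets loses no element:
    \<open>Cbar\<close> has \<open>l\<close> elements and \<open>Dbar\<close> has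
    \<open>length es - k\<close>.\<close>
  show "n = card Dbar - card Cbar"
    unfolding C D using card_image[OF im'(1)] card_image[OF ker'(1)] n by simp
qed

end

section \<open>Assembly of the two steps\<close>

lemma coboundary_step_exists: "\<exists>E. coboundary_step G t i rs cs E"
  using row_reduction_exists unfolding coboundary_step_def by blast

theorem mainTheorem3:
  fixes G :: "('g, 'b) monoid_scheme"
    and cohG :: "nat \<Rightarrow> (bit, 'm) module"
    and d :: "nat \<Rightarrow> 'm \<Rightarrow> 'm"
    and F :: "nat \<Rightarrow> ('g list \<Rightarrow> bit) \<Rightarrow> 'm"
    and K :: "nat \<Rightarrow> 'm \<Rightarrow> 'g list \<Rightarrow> bit"
    and \<phi> :: "nat \<Rightarrow> ('g list \<Rightarrow> bit) \<Rightarrow> 'g list \<Rightarrow> bit"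
    and t i :: nat
    and rs cs :: "'g list list"
    and us es vs :: "'m list"
  assumes "cohomological_model G cohG d F K \<phi>"
    and "finite (carrier G)"
    and "Coset.order G = 4 * t"
    and "i \<ge> 1"
    and "enumerates rs (symbols G (i - 1))"
    and "enumerates cs (symbols G i)"
    and "ordered_basis (cohG (i - 1)) us"
    and "ordered_basis (cohG i) es"
    and "ordered_basis (cohG (i + 1)) vs"
  shows "(\<exists>E. coboundary_step G t i rs cs E) \<and>
    (\<exists>Cbar Dbar n. smith_step cohG d i us es vs Cbar Dbar n) \<and>
    (\<forall>E Cbar Dbar n.
      coboundary_step G t i rs cs E \<longrightarrow>
      smith_step cohG d i us es vs Cbar Dbar n \<longrightarrow>
        subspace_basis (cochains G i) (coboundaries (cochains G) (codifferential G) i) E \<and>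
        subspace_basis (cohG i) (coboundaries cohG d i) Cbar \<and>
        subspace_basis (cohG i) (cocycles cohG d i) Dbar \<and>
        (\<exists>Bbar. selection_step (cohG i) Cbar Dbar n Bbar) \<and>
        (\<forall>Bbar B.
          selection_step (cohG i) Cbar Dbar n Bbar \<longrightarrow>
          B = K i ` Bbar \<longrightarrow>
            representative_cocycle_basis (cochains G) (codifferential G) i B \<and>
            B \<inter> E = {} \<and>
            subspace_basis (cochains G i) (cocycles (cochains G) (codifferential G) i) (B \<union> E)))"
proof -
  interpret cohomological_model G cohG d F K \<phi> by fact
  interpret C: z2_space "cohG i" by (rule M.z2_space)
  interpret V: z2_space "cochains G i" by (rule N.z2_space)
  have vs: "ordered_basis (cohG (Suc i)) vs" using assms(9) by simp
  have "subspace_basis (cochains G i) (coboundaries (cochains G) (codifferential G) i) E \<and>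
        subspace_basis (cohG i) (coboundaries cohG d i) Cbar \<and>
        subspace_basis (cohG i) (cocycles cohG d i) Dbar \<and>
        (\<exists>Bbar. selection_step (cohG i) Cbar Dbar n Bbar) \<and>
        (\<forall>Bbar B.
          selection_step (cohG i) Cbar Dbar n Bbar \<longrightarrow>
          B = K i ` Bbar \<longrightarrow>
            representative_cocycle_basis (cochains G) (codifferential G) i B \<and>
            B \<inter> E = {} \<and>
            subspace_basis (cochains G i) (cocycles (cochains G) (codifferential G) i) (B \<union> E))"
    if E: "coboundary_step G t i rs cs E" and CD: "smith_step cohG d i us es vs Cbar Dbar n"
    for E Cbar Dbar n
  proof -
    note Eb = coboundary_step_basis[OF N.cochain_complex_axioms assms(2-6) E]
    note sb = M.smith_step_bases[OF assms(4,7,8) vs CD]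
    note sel = C.selection_step_completes_basis[OF M.cocycles_subspace M.coboundaries_subspace M.coboundaries_subset_cocycles
        sb(1,3,2,4,5)]
    have "representative_cocycle_basis (cochains G) (codifferential G) i (K i ` Bbar) \<and>
        K i ` Bbar \<inter> E = {} \<and>
        subspace_basis (cochains G i) (cocycles (cochains G) (codifferential G) i) (K i ` Bbar \<union> E)"
      if Bbar: "selection_step (cohG i) Cbar Dbar n Bbar" for Bbar
    proof -
      have fin: "finite Bbar" and disj: "Cbar \<inter> Bbar = {}"
        and CB: "subspace_basis (cohG i) (cocycles cohG d i) (Cbar \<union> Bbar)"
        using sel(2)[OF Bbar] by blast+
      have cb: "complement_basis (cohG i) (cocycles cohG d i) (coboundaries cohG d i) Bbar"
        by (rule C.complement_basis_of_basis[OF M.coboundaries_subspace M.cocycles_subspace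
            sb(1) fin disj sb(3) CB])
      \<comment> \<open>This one complement serves twice: modulo coboundaries it gives the basis of
        cohomology, and together with \<open>E\<close> it gives the basis of all cocycles.\<close>
      note cbK = complement_basis_injection[OF assms(4) fin cb]
      have finK: "finite (K i ` Bbar)" using fin by simp
      show ?thesis
        using N.representative_cocycle_basis_of_complement[OF finK cbK]
          V.basis_of_complement_basis[OF N.coboundaries_subspace N.cocycles_subspace
            N.coboundaries_subset_cocycles Eb(1) finK Eb(2) cbK]
        by blast
    qed
    then show ?thesis using Eb(2) sb(3,4) sel(1) by blast
  qed
  note main = this
  show ?thesis
    by (rule conjI[OF coboundary_step_exists conjI[OF M.smith_step_exists[OF assms(4,7,8) vs]]])
      (intro allI impI, rule main)
qed

end
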